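(* Let $T$ be a (connected) abelian Lie group, $n=\dim T$, with Lie algebra $\mathfrak t$, acting nontrivially by triholomorphic isometries on a connected hyper-Kähler manifold $M$ with zero first Betti number. Let $\phi:M\to(\mathfrak t\otimes\mathrm{Im}\,\mathbb H)^*$ be the hyper-Kähler moment map. Then $\phi$ is a twistorial map; equivalently, $\phi$ corresponds to a holomorphic map from the twistor space of $M$ to (the total space of) $n\mathcal O(2)$, mapping the twistor lines onto the images of sections of $n\mathcal O(2)$.
   Context: Let $(g,J_1,J_2,J_3)$ be the hyper-Kähler structure of $M$ ($J_1J_2=J_3=-J_2J_1$), and for $q=(q^1,q^2,q^3)\in S^2\subseteq\mathrm{Im}\,\mathbb H=\mathbb R^3$ put $J_q=\sum_j q^jJ_j$, with Kähler form $\omega_q(X,Y)=g(J_qX,Y)$. The $J_q$ are called the admissible Kähler structures. An isometry is triholomorphic if it is holomorphic with respect to $J_1,J_2,J_3$. The hyper-Kähler moment map $\phi:M\to(\mathfrak t\otimes\mathrm{Im}\,\mathbb H)^*$ is characterised by the following: for any $v\in\mathfrak t$ and unit $q\in\mathrm{Im}\,\mathbb H$, the function $x\mapsto\phi(x)(v\otimes q)$ is the Hamiltonian, with respect to $\omega_q$, of the fundamental vector field $V$ on $M$ corresponding to $v$ (i.e. its differential is $\omega_q(V,\cdot)$, up to a global sign convention). The twistor space of $M$ is $Z=M\times S^2$ with the complex structure which at $(x,q)$ is $J_q$ on $T_xM$ and is $w\mapsto qw$ (quaternionic multiplication) on $T_qS^2=q^\perp\subseteq\mathrm{Im}\,\mathbb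 H$. The twistor lines are $\{x\}\times S^2$, $x\in M$. With the same complex structure on $S^2=\mathbb CP^1$, the holomorphic tangent bundle $TS^2$ is $\mathcal O(2)$, the holomorphic line bundle of Chern number $2$, so $\mathfrak t^*\otimes TS^2\cong n\mathcal O(2)=\mathcal O(2)^{\oplus n}$. This is the twistor space of $(\mathfrak t\otimes\mathrm{Im}\,\mathbb H)^*=\mathfrak t^*\otimes\mathrm{Im}\,\mathbb H$ (identifying $(\mathrm{Im}\,\mathbb H)^*=\mathrm{Im}\,\mathbb H$ by the Euclidean structure): an element $a\in\mathfrak t^*\otimes\mathrm{Im}\,\mathbb H$ corresponds to the holomorphic section $s_a$ of $n\mathcal O(2)$ whose value at $q$ is the image of $a$ under the orthogonal projection $\mathfrak t^*\otimes\mathrm{Im}\,\mathbb H\to\mathfrak t^*\otimes T_qS^2$. The map corresponding to $\phi$ is $\Phi:Z\to n\mathcal O(2)$, $\Phi(x,q)=s_{\phi(x)}(q)$. It maps the twistor line $\{x\}\times S^2$ onto the image of the section $s_{\phi(x)}$. That $\phi$ is twistorial means that $\Phi$ is holomorphic. An action is nontrivial if it has at least one orbit that is not a fixed point. *)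

theory Defs
  imports
    "HOL-Analysis.Analysis"
    "HOL-Homology.Homology"
    "HOL-Algebra.Group_Action"
    "HOL-Library.Function_Algebras"
    "HOL-Library.Extended_Nat"
begin

section \<open>Functions into a real vector space form a real vector space\<close>

instantiation "fun" :: (type, real_vector) real_vector
begin

definition scaleR_fun :: "real \<Rightarrow> ('a \<Rightarrow> 'b) \<Rightarrow> 'a \<Rightarrow> 'b"
  where "scaleR_fun r f = (\<lambda>x. r *\<^sub>R f x)"

instance
  by standard (simp_all add: scaleR_fun_def fun_eq_iff scaleR_add_right scaleR_add_left)

end

definition linear_on :: "'a::real_vector set \<Rightarrow> ('a \<Rightarrow> 'b::real_vector) \<Rightarrow> bool"
  where "linear_on S f \<longleftrightarrow>
    (\<forall>x\<in>S. \<forall>y\<in>S. f (x + y) = f x + f y) \<and> (\<forall>r. \<forall>x\<in>S. f (r *\<^sub>R x) = r *\<^sub>R f x)"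


section \<open>Smooth manifolds\<close>

text \<open>The next two notions are only used on open sets.\<close>

fun Ck_on :: "nat \<Rightarrow> ('a::euclidean_space \<Rightarrow> 'b::real_normed_vector) \<Rightarrow> 'a set \<Rightarrow> bool"
  where
    "Ck_on 0 f S \<longleftrightarrow> continuous_on S f"
  | "Ck_on (Suc k) f S \<longleftrightarrow>
      f differentiable_on S \<and> (\<forall>v. Ck_on k (\<lambda>x. frechet_derivative f (at x) v) S)"

definition smooth_on :: "'a::euclidean_space set \<Rightarrow> ('a \<Rightarrow> 'b::real_normed_vector) \<Rightarrow> bool"
  where "smooth_on S f \<longleftrightarrow> (\<forall>k. Ck_on k f S)"

text \<open>
  A chart is a pair of its domain and its coordinate map; the values of the coordinate map outside
  the domain are irrelevant. A manifold is given by an atlas, which determines both the underlying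
  set of points and the topology.
\<close>

type_synonym ('m, 'e) chart = "'m set \<times> ('m \<Rightarrow> 'e)"

definition chart_inv :: "('m, 'e) chart \<Rightarrow> 'e \<Rightarrow> 'm"
  where "chart_inv c = inv_into (fst c) (snd c)"

definition points :: "('m, 'e) chart set \<Rightarrow> 'm set"
  where "points A = \<Union> (fst ` A)"

definition smooth_atlas :: "('m, 'e::euclidean_space) chart set \<Rightarrow> bool"
  where "smooth_atlas A \<longleftrightarrow>
    (\<forall>c\<in>A. inj_on (snd c) (fst c) \<and> open (snd c ` fst c)) \<and>
    (\<forall>c\<in>A. \<forall>d\<in>A. open (snd c ` (fst c \<inter> fst d)) \<and>
       smooth_on (snd c ` (fst c \<inter> fst d)) (snd d \<circ> chart_inv c))"

definition maximal_atlas :: "('m, 'e::euclidean_space) chart set \<Rightarrow> ('m, 'e) chart set"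
  where "maximal_atlas A = {z. fst z \<subseteq> points A \<and> smooth_atlas (insert z A)}"

definition manifold_topology :: "('m, 'e::euclidean_space) chart set \<Rightarrow> 'm topology"
  where "manifold_topology A =
    topology (\<lambda>W. W \<subseteq> points A \<and> (\<forall>c\<in>A. open (snd c ` (W \<inter> fst c))))"

lemma openin_manifold_topology:
  assumes "smooth_atlas A"
  shows "openin (manifold_topology A) W \<longleftrightarrow>
    W \<subseteq> points A \<and> (\<forall>c\<in>A. open (snd c ` (W \<inter> fst c)))"
proof -
  have int: "snd c ` (V \<inter> W \<inter> fst c) = snd c ` (V \<inter> fst c) \<inter> snd c ` (W \<inter> fst c)"
    if "c \<in> A" for c V W
  proof -
    have "inj_on (snd c) (fst c)"
      using assms that by (auto simp: smooth_atlas_def)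
    then have "snd c ` ((V \<inter> fst c) \<inter> (W \<inter> fst c)) = snd c ` (V \<inter> fst c) \<inter> snd c ` (W \<inter> fst c)"
      by (intro inj_on_image_Int) auto
    moreover have "(V \<inter> fst c) \<inter> (W \<inter> fst c) = V \<inter> W \<inter> fst c"
      by blast
    ultimately show ?thesis by simp
  qed
  have un: "snd c ` (\<Union>K \<inter> fst c) = (\<Union>V\<in>K. snd c ` (V \<inter> fst c))" for c K
    by blast
  have "istopology (\<lambda>W. W \<subseteq> points A \<and> (\<forall>c\<in>A. open (snd c ` (W \<inter> fst c))))"
    unfolding istopology_def by (auto simp: int un)
  then show ?thesis
    unfolding manifold_topology_def by (simp add: topology_inverse')
qed

definition smooth_manifold :: "('m, 'e::euclidean_space) chart set \<Rightarrow> bool"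
  where "smooth_manifold A \<longleftrightarrow> smooth_atlas A \<and>
    Hausdorff_space (manifold_topology A) \<and> second_countable (manifold_topology A)"

definition prod_atlas ::
    "('m, 'e) chart set \<Rightarrow> ('n, 'f) chart set \<Rightarrow> ('m \<times> 'n, 'e \<times> 'f) chart set"
  where "prod_atlas A B =
    {(fst c \<times> fst d, map_prod (snd c) (snd d)) | c d. c \<in> A \<and> d \<in> B}"

text \<open>The openness requirement, for all charts, expresses continuity.\<close>

definition smooth_map ::
    "('m, 'e::euclidean_space) chart set \<Rightarrow> ('n, 'f::euclidean_space) chart set \<Rightarrow> ('m \<Rightarrow> 'n) \<Rightarrow> bool"
  where "smooth_map A B F \<longleftrightarrow> F ` points A \<subseteq> points B \<and>
    (\<forall>c\<in>A. \<forall>d\<in>B. open (snd c ` {x\<in>fst c. F x \<in> fst d}) \<and>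
       smooth_on (snd c ` {x\<in>fst c. F x \<in> fst d}) (snd d \<circ> F \<circ> chart_inv c))"

definition smooth_function ::
    "('m, 'e::euclidean_space) chart set \<Rightarrow> ('m \<Rightarrow> 'v::real_normed_vector) \<Rightarrow> bool"
  where "smooth_function A f \<longleftrightarrow> (\<forall>c\<in>A. smooth_on (snd c ` fst c) (f \<circ> chart_inv c))"


section \<open>Tangent vectors\<close>

text \<open>
  A tangent vector at a point is the family of its coordinate vectors with respect to the charts
  of the atlas around the point, related by the Jacobians of the coordinate changes. The family is
  set to zero at all other charts, so that the vector space operations are those of functions.
\<close>

type_synonym ('m, 'e) tangent = "('m, 'e) chart \<Rightarrow> 'e"

definition tangent_space ::
    "('m, 'e::euclidean_space) chart set \<Rightarrow> 'm \<Rightarrow> ('m, 'e) tangent set"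
  where "tangent_space A x = {\<xi>.
    (\<forall>c\<in>A. \<forall>d\<in>A. x \<in> fst c \<inter> fst d \<longrightarrow>
       \<xi> d = frechet_derivative (snd d \<circ> chart_inv c) (at (snd c x)) (\<xi> c)) \<and>
    (\<forall>c. \<not> (c \<in> A \<and> x \<in> fst c) \<longrightarrow> \<xi> c = 0)}"

text \<open>The tangent vector at \<open>x\<close> with coordinates \<open>u\<close> in the chart \<open>c\<close>.\<close>

definition coord_vector ::
    "('m, 'e::euclidean_space) chart set \<Rightarrow> ('m, 'e) chart \<Rightarrow> 'm \<Rightarrow> 'e \<Rightarrow> ('m, 'e) tangent"
  where "coord_vector A c x u = (\<lambda>d. if d \<in> A \<and> x \<in> fst d
    then frechet_derivative (snd d \<circ> chart_inv c) (at (snd c x)) u else 0)"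

text \<open>The differential of a function with values in a normed space, and of a map of manifolds.\<close>

definition differential_fun ::
    "('m, 'e::euclidean_space) chart set \<Rightarrow> ('m \<Rightarrow> 'v::real_normed_vector) \<Rightarrow> 'm \<Rightarrow>
     ('m, 'e) tangent \<Rightarrow> 'v"
  where "differential_fun A f x \<xi> = (let c = (SOME c. c \<in> A \<and> x \<in> fst c)
    in frechet_derivative (f \<circ> chart_inv c) (at (snd c x)) (\<xi> c))"

definition differential ::
    "('m, 'e::euclidean_space) chart set \<Rightarrow> ('n, 'f::euclidean_space) chart set \<Rightarrow> ('m \<Rightarrow> 'n) \<Rightarrow>
     'm \<Rightarrow> ('m, 'e) tangent \<Rightarrow> ('n, 'f) tangent"
  where "differential A B F x \<xi> = (\<lambda>d. if d \<in> B \<and> F x \<in> fst d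
    then differential_fun A (snd d \<circ> F) x \<xi> else 0)"


section \<open>Hyper-Kaehler structures\<close>

definition riemannian_metric ::
    "('m, 'e::euclidean_space) chart set \<Rightarrow>
     ('m \<Rightarrow> ('m, 'e) tangent \<Rightarrow> ('m, 'e) tangent \<Rightarrow> real) \<Rightarrow> bool"
  where "riemannian_metric A g \<longleftrightarrow>
    (\<forall>x\<in>points A. \<forall>\<xi>\<in>tangent_space A x.
       linear_on (tangent_space A x) (g x \<xi>) \<and>
       (\<forall>\<eta>\<in>tangent_space A x. g x \<xi> \<eta> = g x \<eta> \<xi>) \<and>
       (\<xi> \<noteq> 0 \<longrightarrow> g x \<xi> \<xi> > 0)) \<and>
    (\<forall>c\<in>A. \<forall>u v. smooth_on (snd c ` fst c) (\<lambda>y. let x = chart_inv c y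
       in g x (coord_vector A c x u) (coord_vector A c x v)))"

definition almost_complex ::
    "('m, 'e::euclidean_space) chart set \<Rightarrow> ('m \<Rightarrow> ('m, 'e) tangent \<Rightarrow> ('m, 'e) tangent) \<Rightarrow> bool"
  where "almost_complex A J \<longleftrightarrow>
    (\<forall>x\<in>points A. linear_on (tangent_space A x) (J x) \<and>
       (\<forall>\<xi>\<in>tangent_space A x. J x \<xi> \<in> tangent_space A x \<and> J x (J x \<xi>) = - \<xi>)) \<and>
    (\<forall>c\<in>A. \<forall>u. smooth_on (snd c ` fst c) (\<lambda>y. let x = chart_inv c y
       in J x (coord_vector A c x u) c))"

text \<open>
  Integrability: there are holomorphic coordinates around every point, that is, smooth coordinates
  with values in a complex vector space (the model space together with some linear complex
  structure \<open>I\<close>) whose differential intertwines \<open>J\<close> and \<open>I\<close>.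
\<close>

definition integrable_complex ::
    "('m, 'e::euclidean_space) chart set \<Rightarrow> ('m \<Rightarrow> ('m, 'e) tangent \<Rightarrow> ('m, 'e) tangent) \<Rightarrow> bool"
  where "integrable_complex A J \<longleftrightarrow>
    (\<forall>p\<in>points A. \<exists>z I. z \<in> maximal_atlas A \<and> p \<in> fst z \<and> linear I \<and> (\<forall>u. I (I u) = - u) \<and>
       (\<forall>x\<in>fst z. \<forall>\<xi>\<in>tangent_space A x.
          differential_fun A (snd z) x (J x \<xi>) = I (differential_fun A (snd z) x \<xi>)))"

text \<open>
  For a 2-form with local coefficients \<open>w u v\<close>, the formula is the value of its exterior derivative
  on the constant coordinate fields \<open>u1, u2, u3\<close>.
\<close>

definition closed_2form ::
    "('m, 'e::euclidean_space) chart set \<Rightarrow>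
     ('m \<Rightarrow> ('m, 'e) tangent \<Rightarrow> ('m, 'e) tangent \<Rightarrow> real) \<Rightarrow> bool"
  where "closed_2form A \<omega> \<longleftrightarrow> (\<forall>c\<in>A.
    let w = (\<lambda>u v y. let x = chart_inv c y in \<omega> x (coord_vector A c x u) (coord_vector A c x v))
    in \<forall>y\<in>snd c ` fst c. \<forall>u1 u2 u3.
      frechet_derivative (w u2 u3) (at y) u1 + frechet_derivative (w u3 u1) (at y) u2 +
      frechet_derivative (w u1 u2) (at y) u3 = 0)"

definition kaehler ::
    "('m, 'e::euclidean_space) chart set \<Rightarrow>
     ('m \<Rightarrow> ('m, 'e) tangent \<Rightarrow> ('m, 'e) tangent \<Rightarrow> real) \<Rightarrow>
     ('m \<Rightarrow> ('m, 'e) tangent \<Rightarrow> ('m, 'e) tangent) \<Rightarrow> bool"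
  where "kaehler A g J \<longleftrightarrow> riemannian_metric A g \<and> almost_complex A J \<and> integrable_complex A J \<and>
    (\<forall>x\<in>points A. \<forall>\<xi>\<in>tangent_space A x. \<forall>\<eta>\<in>tangent_space A x. g x (J x \<xi>) (J x \<eta>) = g x \<xi> \<eta>) \<and>
    closed_2form A (\<lambda>x \<xi> \<eta>. g x (J x \<xi>) \<eta>)"

definition hyperkaehler ::
    "('m, 'e::euclidean_space) chart set \<Rightarrow>
     ('m \<Rightarrow> ('m, 'e) tangent \<Rightarrow> ('m, 'e) tangent \<Rightarrow> real) \<Rightarrow>
     (3 \<Rightarrow> 'm \<Rightarrow> ('m, 'e) tangent \<Rightarrow> ('m, 'e) tangent) \<Rightarrow> bool"
  where "hyperkaehler A g J \<longleftrightarrow> smooth_manifold A \<and> (\<forall>j. kaehler A g (J j)) \<and>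
    (\<forall>x\<in>points A. \<forall>\<xi>\<in>tangent_space A x.
       J 1 x (J 2 x \<xi>) = J 3 x \<xi> \<and> J 2 x (J 1 x \<xi>) = - J 3 x \<xi>)"

text \<open>The imaginary quaternions are \<^typ>\<open>real^3\<close>.\<close>

definition admissible ::
    "(3 \<Rightarrow> 'm \<Rightarrow> ('m, 'e) tangent \<Rightarrow> ('m, 'e::euclidean_space) tangent) \<Rightarrow> real^3 \<Rightarrow>
     'm \<Rightarrow> ('m, 'e) tangent \<Rightarrow> ('m, 'e) tangent"
  where "admissible J q x \<xi> = (\<Sum>j\<in>UNIV. (q $ j) *\<^sub>R J j x \<xi>)"

definition kaehler_form ::
    "('m \<Rightarrow> ('m, 'e) tangent \<Rightarrow> ('m, 'e) tangent \<Rightarrow> real) \<Rightarrow>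
     (3 \<Rightarrow> 'm \<Rightarrow> ('m, 'e) tangent \<Rightarrow> ('m, 'e::euclidean_space) tangent) \<Rightarrow> real^3 \<Rightarrow>
     'm \<Rightarrow> ('m, 'e) tangent \<Rightarrow> ('m, 'e) tangent \<Rightarrow> real"
  where "kaehler_form g J q x \<xi> \<eta> = g x (admissible J q x \<xi>) \<eta>"


section \<open>Betti numbers\<close>

definition abelian_rank :: "('a, 'b) monoid_scheme \<Rightarrow> enat"
  where "abelian_rank G = (SUP S\<in>{S. finite S \<and> S \<subseteq> carrier G \<and>
    (\<forall>k :: 'a \<Rightarrow> int. finprod G (\<lambda>s. s [^]\<^bsub>G\<^esub> k s) S = \<one>\<^bsub>G\<^esub> \<longrightarrow> (\<forall>s\<in>S. k s = 0))}. enat (card S))"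

definition betti_number :: "nat \<Rightarrow> 'a topology \<Rightarrow> enat"
  where "betti_number p X = abelian_rank (homology_group (int p) X)"


section \<open>Lie group actions and moment maps\<close>

definition lie_group :: "('t, 'z) monoid_scheme \<Rightarrow> ('t, 'e::euclidean_space) chart set \<Rightarrow> bool"
  where "lie_group T AT \<longleftrightarrow> group T \<and> smooth_manifold AT \<and> points AT = carrier T \<and>
    smooth_map (prod_atlas AT AT) AT (\<lambda>(s, t). s \<otimes>\<^bsub>T\<^esub> t) \<and>
    smooth_map AT AT (\<lambda>t. inv\<^bsub>T\<^esub> t)"

definition lie_algebra ::
    "('t, 'z) monoid_scheme \<Rightarrow> ('t, 'e::euclidean_space) chart set \<Rightarrow> ('t, 'e) tangent set"
  where "lie_algebra T AT = tangent_space AT \<one>\<^bsub>T\<^esub>"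

definition lie_group_action ::
    "('t, 'z) monoid_scheme \<Rightarrow> ('t, 'f::euclidean_space) chart set \<Rightarrow>
     ('m, 'e::euclidean_space) chart set \<Rightarrow> ('t \<Rightarrow> 'm \<Rightarrow> 'm) \<Rightarrow> bool"
  where "lie_group_action T AT A \<rho> \<longleftrightarrow> lie_group T AT \<and> group_action T (points A) \<rho> \<and>
    smooth_map (prod_atlas AT A) A (\<lambda>(t, x). \<rho> t x)"

definition triholomorphic_isometries ::
    "('t, 'z) monoid_scheme \<Rightarrow> ('m, 'e::euclidean_space) chart set \<Rightarrow>
     ('m \<Rightarrow> ('m, 'e) tangent \<Rightarrow> ('m, 'e) tangent \<Rightarrow> real) \<Rightarrow>
     (3 \<Rightarrow> 'm \<Rightarrow> ('m, 'e) tangent \<Rightarrow> ('m, 'e) tangent) \<Rightarrow> ('t \<Rightarrow> 'm \<Rightarrow> 'm) \<Rightarrow> bool"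
  where "triholomorphic_isometries T A g J \<rho> \<longleftrightarrow>
    (\<forall>t\<in>carrier T. \<forall>x\<in>points A. \<forall>\<xi>\<in>tangent_space A x.
       (\<forall>\<eta>\<in>tangent_space A x.
          g (\<rho> t x) (differential A A (\<rho> t) x \<xi>) (differential A A (\<rho> t) x \<eta>) = g x \<xi> \<eta>) \<and>
       (\<forall>j. differential A A (\<rho> t) x (J j x \<xi>) = J j (\<rho> t x) (differential A A (\<rho> t) x \<xi>)))"

definition nontrivial_action ::
    "('t, 'z) monoid_scheme \<Rightarrow> ('m, 'e) chart set \<Rightarrow> ('t \<Rightarrow> 'm \<Rightarrow> 'm) \<Rightarrow> bool"
  where "nontrivial_action T A \<rho> \<longleftrightarrow> (\<exists>x\<in>points A. Group_Action.orbit T \<rho> x \<noteq> {x})"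

definition fundamental_field ::
    "('t, 'z) monoid_scheme \<Rightarrow> ('t, 'f::euclidean_space) chart set \<Rightarrow>
     ('m, 'e::euclidean_space) chart set \<Rightarrow> ('t \<Rightarrow> 'm \<Rightarrow> 'm) \<Rightarrow> ('t, 'f) tangent \<Rightarrow>
     'm \<Rightarrow> ('m, 'e) tangent"
  where "fundamental_field T AT A \<rho> v x = differential AT A (\<lambda>t. \<rho> t x) \<one>\<^bsub>T\<^esub> v"

text \<open>
  A linear form on the tensor product of the Lie algebra with the imaginary quaternions is given
  as a bilinear form, whose value at \<open>v, q\<close> is that of the linear form at the decomposable tensor
  of \<open>v\<close> and \<open>q\<close>. The sign \<open>\<sigma>\<close> covers both sign conventions for Hamiltonians.
\<close>

definition hyperkaehler_moment_map ::
    "('t, 'z) monoid_scheme \<Rightarrow> ('t, 'f::euclidean_space) chart set \<Rightarrow>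
     ('m, 'e::euclidean_space) chart set \<Rightarrow>
     ('m \<Rightarrow> ('m, 'e) tangent \<Rightarrow> ('m, 'e) tangent \<Rightarrow> real) \<Rightarrow>
     (3 \<Rightarrow> 'm \<Rightarrow> ('m, 'e) tangent \<Rightarrow> ('m, 'e) tangent) \<Rightarrow> ('t \<Rightarrow> 'm \<Rightarrow> 'm) \<Rightarrow>
     ('m \<Rightarrow> ('t, 'f) tangent \<Rightarrow> real^3 \<Rightarrow> real) \<Rightarrow> bool"
  where "hyperkaehler_moment_map T AT A g J \<rho> \<phi> \<longleftrightarrow>
    (\<forall>x\<in>points A. (\<forall>v\<in>lie_algebra T AT. linear (\<phi> x v)) \<and>
       (\<forall>q. linear_on (lie_algebra T AT) (\<lambda>v. \<phi> x v q))) \<and>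
    (\<exists>\<sigma>\<in>{1, -1}. \<forall>v\<in>lie_algebra T AT. \<forall>q\<in>sphere 0 1.
       smooth_function A (\<lambda>x. \<phi> x v q) \<and>
       (\<forall>x\<in>points A. \<forall>\<xi>\<in>tangent_space A x.
          differential_fun A (\<lambda>y. \<phi> y v q) x \<xi> =
          \<sigma> * kaehler_form g J q x (fundamental_field T AT A \<rho> v x) \<xi>))"


section \<open>Holomorphic maps\<close>

definition holomorphic_map ::
    "('m, 'e::euclidean_space) chart set \<Rightarrow> ('m \<Rightarrow> ('m, 'e) tangent \<Rightarrow> ('m, 'e) tangent) \<Rightarrow>
     ('n, 'f::euclidean_space) chart set \<Rightarrow> ('n \<Rightarrow> ('n, 'f) tangent \<Rightarrow> ('n, 'f) tangent) \<Rightarrow>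
     ('m \<Rightarrow> 'n) \<Rightarrow> bool"
  where "holomorphic_map A J B K F \<longleftrightarrow> smooth_map A B F \<and>
    (\<forall>x\<in>points A. \<forall>\<xi>\<in>tangent_space A x.
       differential A B F x (J x \<xi>) = K (F x) (differential A B F x \<xi>))"


section \<open>The sphere and its complex structure\<close>

text \<open>
  Stereographic projections from the north and the south pole. The first one is composed with
  complex conjugation: the coordinate change is then \<open>z \<mapsto> 1/z\<close>, and both are holomorphic for the
  complex structure \<open>sphere_J\<close> below.
\<close>

definition sphere_atlas :: "(real^3, complex) chart set"
  where "sphere_atlas =
    {({q \<in> sphere 0 1. q $ 3 \<noteq> 1}, \<lambda>q. Complex (q $ 1 / (1 - q $ 3)) (- q $ 2 / (1 - q $ 3))),
     ({q \<in> sphere 0 1. q $ 3 \<noteq> - 1}, \<lambda>q. Complex (q $ 1 / (1 + q $ 3)) (q $ 2 / (1 + q $ 3)))}"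

text \<open>
  The differential of the inclusion of the sphere identifies the tangent space at \<open>q\<close> with the
  orthogonal complement of \<open>q\<close>; \<open>sphere_vector q\<close> is the inverse of this identification.
\<close>

definition sphere_incl :: "real^3 \<Rightarrow> (real^3, complex) tangent \<Rightarrow> real^3"
  where "sphere_incl q = differential_fun sphere_atlas (\<lambda>p. p) q"

definition sphere_vector :: "real^3 \<Rightarrow> real^3 \<Rightarrow> (real^3, complex) tangent"
  where "sphere_vector q = inv_into (tangent_space sphere_atlas q) (sphere_incl q)"

text \<open>
  The product of imaginary quaternions \<open>q, w\<close> has real part \<open>- (q \<bullet> w)\<close> and imaginary part
  \<open>cross3 q w\<close>; hence it is \<open>cross3 q w\<close> for \<open>w\<close> orthogonal to \<open>q\<close>.
\<close>

definition sphere_J :: "real^3 \<Rightarrow> (real^3, complex) tangent \<Rightarrow> (real^3, complex) tangent"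
  where "sphere_J q \<xi> = sphere_vector q (cross3 q (sphere_incl q \<xi>))"


section \<open>The twistor space\<close>

definition twistor_atlas ::
    "('m, 'e::euclidean_space) chart set \<Rightarrow> ('m \<times> (real^3), 'e \<times> complex) chart set"
  where "twistor_atlas A = prod_atlas A sphere_atlas"

text \<open>
  A tangent vector of the product is split by the differentials of the two projections; the
  summands are put together by the differentials of the two slice inclusions.
\<close>

definition twistor_J ::
    "('m, 'e::euclidean_space) chart set \<Rightarrow>
     (3 \<Rightarrow> 'm \<Rightarrow> ('m, 'e) tangent \<Rightarrow> ('m, 'e) tangent) \<Rightarrow>
     'm \<times> (real^3) \<Rightarrow> ('m \<times> (real^3), 'e \<times> complex) tangent \<Rightarrow> ('m \<times> (real^3), 'e \<times> complex) tangent"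
  where "twistor_J A J = (\<lambda>(x, q) \<zeta>.
    differential A (twistor_atlas A) (\<lambda>y. (y, q)) x
      (admissible J q x (differential (twistor_atlas A) A fst (x, q) \<zeta>)) +
    differential sphere_atlas (twistor_atlas A) (\<lambda>p. (x, p)) q
      (sphere_J q (differential (twistor_atlas A) sphere_atlas snd (x, q) \<zeta>)))"


section \<open>The total space of $n{\cal O}(2)$\<close>

text \<open>
  For a vector space \<open>t\<close> of dimension \<open>n\<close>, the bundle is the tensor product of the dual of \<open>t\<close> and
  the holomorphic tangent bundle of the sphere: its fibre at \<open>q\<close> consists of the linear maps from
  \<open>t\<close> to the tangent space of the sphere at \<open>q\<close>. A holomorphic coordinate of the sphere and a basis
  of \<open>t\<close> induce holomorphic coordinates on the total space.
\<close>

type_synonym 'v nO2_point = "(real^3) \<times> ('v \<Rightarrow> (real^3, complex) tangent)"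

definition nO2_points :: "'v::real_vector set \<Rightarrow> 'v nO2_point set"
  where "nO2_points t = {(q, L). q \<in> sphere 0 1 \<and> L \<in> extensional t \<and> linear_on t L \<and>
    L ` t \<subseteq> tangent_space sphere_atlas q}"

definition nO2_atlas ::
    "('t, real^'n) tangent set \<Rightarrow>
     (('t, real^'n) tangent nO2_point, complex \<times> (complex^'n)) chart set"
  where "nO2_atlas t =
    {({(q, L) \<in> nO2_points t. q \<in> fst d}, \<lambda>(q, L). (snd d q, \<chi> k. L (b k) d)) | d b.
       d \<in> sphere_atlas \<and> inj b \<and> independent (range b) \<and> span (range b) = t}"

text \<open>
  The complex structure is multiplication by the imaginary unit in each of these coordinates.
\<close>

definition nO2_J ::
    "'p \<Rightarrow> ('p, complex \<times> (complex^'n)) tangent \<Rightarrow> ('p, complex \<times> (complex^'n)) tangent"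
  where "nO2_J p \<xi> = (\<lambda>c. (\<i> * fst (\<xi> c), \<chi> k. \<i> * snd (\<xi> c) $ k))"

text \<open>
  The section given by a linear form \<open>f\<close> on the tensor product of \<open>t\<close> with the imaginary quaternions
  (a bilinear form, as above): by the Euclidean structure, \<open>f v\<close> is the inner product with the
  vector \<open>im_dual (f v)\<close>, which is projected orthogonally to the complement of \<open>q\<close>.
\<close>

definition im_dual :: "(real^3 \<Rightarrow> real) \<Rightarrow> real^3"
  where "im_dual h = (\<chi> j. h (axis j 1))"

definition nO2_section ::
    "'v::real_vector set \<Rightarrow> ('v \<Rightarrow> real^3 \<Rightarrow> real) \<Rightarrow> real^3 \<Rightarrow> 'v nO2_point"
  where "nO2_section t f q = (q, \<lambda>v\<in>t.
    let a = im_dual (f v) in sphere_vector q (a - (a \<bullet> q) *\<^sub>R q))"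

definition holomorphic_section ::
    "('t, real^'n) tangent set \<Rightarrow> (real^3 \<Rightarrow> ('t, real^'n) tangent nO2_point) \<Rightarrow> bool"
  where "holomorphic_section t s \<longleftrightarrow> (\<forall>q\<in>sphere 0 1. fst (s q) = q) \<and>
    holomorphic_map sphere_atlas sphere_J (nO2_atlas t) nO2_J s"


section \<open>Twistorial maps\<close>

definition twistor_map ::
    "'v::real_vector set \<Rightarrow> ('m \<Rightarrow> 'v \<Rightarrow> real^3 \<Rightarrow> real) \<Rightarrow> 'm \<times> (real^3) \<Rightarrow> 'v nO2_point"
  where "twistor_map t \<phi> = (\<lambda>(x, q). nO2_section t (\<phi> x) q)"

definition twistorial ::
    "('m, 'e::euclidean_space) chart set \<Rightarrow>
     (3 \<Rightarrow> 'm \<Rightarrow> ('m, 'e) tangent \<Rightarrow> ('m, 'e) tangent) \<Rightarrow> ('t, real^'n) tangent set \<Rightarrow>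
     ('m \<Rightarrow> ('t, real^'n) tangent \<Rightarrow> real^3 \<Rightarrow> real) \<Rightarrow> bool"
  where "twistorial A J t \<phi> \<longleftrightarrow>
    holomorphic_map (twistor_atlas A) (twistor_J A J) (nO2_atlas t) nO2_J (twistor_map t \<phi>)"

end

theory Submission
  imports Defs
begin

text \<open>
  Let \<open>m\<close> be the imaginary quaternion dual to the moment map paired with \<open>v\<close>. The moment map
  equation says that the \<open>j\<close>-th component of \<open>dm(X)\<close> is \<open>\<plusminus>g(J\<^sub>j V, X)\<close>, and the
  quaternion relations turn this into \<open>dm(J\<^sub>q X) = r q + q \<times> dm(X)\<close> for some real \<open>r\<close>. The
  projection to the tangent space of the sphere at \<open>q\<close> kills \<open>r q\<close>, and \<open>q \<times> _\<close> is the complex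
  structure there, so the twistor map is holomorphic along \<open>M\<close>. Along the twistor lines it is
  holomorphic because, in a stereographic coordinate \<open>z\<close>, the projection of a constant vector to
  the tangent spaces of the sphere is a polynomial of degree two in \<open>z\<close>, without \<open>cnj z\<close>.
\<close>

section \<open>Calculus of $C^k$ functions on open sets\<close>

text \<open>In bundle coordinates the twistor map is the pair of z and P(z, m), where P is
  \<open>nO2_poly\<close>, real linear in m and quadratic in z. Its derivative is P(z, dm) + (dP/dz)
  dz. The second summand is complex linear as soon as the base map to the sphere is holomorphic; the
  first one needs P(z, dm(J X)) = i P(z, dm(X)), which is what the identity for dm yields. These two
  conditions make up one criterion, \<open>holomorphic_map_nO2_section\<close>, for an arbitrary
  base map: the projection of the twistor space to the sphere gives the twistor map, and the
  identity of the sphere, with m constant, gives the sections. The real number r is g(V, X) up to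
  the sign convention; it comes from the terms of g(J_j V, J_q X) in which the square of a J_j
  occurs. Orientations have to agree: J_1 J_2 = J_3 must match the orientation of the cross product,
  and the cross product must become multiplication by i in both stereographic charts.\<close>

lemma Ck_on_differentiable_at:
  assumes "Ck_on (Suc k) f S" "open S" "x \<in> S"
  shows "f differentiable (at x)"
  using assms at_within_open[of x S] by (metis Ck_on.simps(2) differentiable_on_def)

lemma Ck_on_has_derivative:
  assumes "Ck_on (Suc k) f S" "open S" "x \<in> S"
  shows "(f has_derivative frechet_derivative f (at x)) (at x)"
  using Ck_on_differentiable_at[OF assms] frechet_derivative_works by blast

text \<open>A derivative at a point depends on a whole neighbourhood, hence the openness. Coordinate
  expressions are controlled only on chart domains, because \<open>chart_inv\<close> is arbitrary
  elsewhere; this congruence permits simplifying them there.\<close>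

lemma Ck_on_cong:
  assumes "open S" "Ck_on k f S" "\<And>x. x \<in> S \<Longrightarrow> f x = g x"
  shows "Ck_on k g S"
  using assms(2,3)
proof (induction k arbitrary: f g)
  case 0
  then show ?case using continuous_on_cong by fastforce
next
  case (Suc k)
  have der: "(g has_derivative frechet_derivative f (at x)) (at x)" if "x \<in> S" for x
    using has_derivative_transform_within_open[OF Ck_on_has_derivative[OF Suc.prems(1) assms(1) that] assms(1) that]
      Suc.prems(2) by blast
  then have "frechet_derivative f (at x) = frechet_derivative g (at x)" if "x \<in> S" for x
    using frechet_derivative_at that by blast
  then have "Ck_on k (\<lambda>x. frechet_derivative g (at x) v) S" for v
    using Suc.IH[of "\<lambda>x. frechet_derivative f (at x) v"] Suc.prems(1) by simp
  moreover have "g differentiable_on S"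
    using der by (auto simp: differentiable_on_def differentiable_def intro: has_derivative_at_withinI)
  ultimately show ?case by simp
qed

text \<open>Lets inductions on the order run on an explicit derivative, which uniqueness of
  derivatives identifies with \<open>frechet_derivative\<close>.\<close>

lemma Ck_on_SucI:
  assumes "open S"
    and "\<And>x. x \<in> S \<Longrightarrow> (f has_derivative f' x) (at x)"
    and "\<And>v. Ck_on k (\<lambda>x. f' x v) S"
  shows "Ck_on (Suc k) f S"
proof -
  have "f' x = frechet_derivative f (at x)" if "x \<in> S" for x
    using frechet_derivative_at assms(2) that by blast
  then have "Ck_on k (\<lambda>x. frechet_derivative f (at x) v) S" for v
    using Ck_on_cong[OF assms(1) assms(3)[of v]] by simp
  moreover have "f differentiable_on S"
    using assms(2) by (auto simp: differentiable_on_def differentiable_def intro: has_derivative_at_withinI)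
  ultimately show ?thesis by simp
qed

lemma Ck_on_subset:
  assumes "Ck_on k f S" "T \<subseteq> S"
  shows "Ck_on k f T"
  using assms by (induction k arbitrary: f)
    (auto intro: continuous_on_subset differentiable_on_subset)

lemma Ck_on_local:
  assumes "\<And>x. x \<in> S \<Longrightarrow> \<exists>U. open U \<and> x \<in> U \<and> Ck_on k f U"
  shows "Ck_on k f S"
  using assms
proof (induction k arbitrary: f)
  case 0
  then show ?case
    by (metis Ck_on.simps(1) continuous_at_imp_continuous_on continuous_on_eq_continuous_at)
next
  case (Suc k)
  have "f differentiable (at x)" if "x \<in> S" for x
    using Suc.prems[OF that] Ck_on_differentiable_at by blast
  moreover have "Ck_on k (\<lambda>x. frechet_derivative f (at x) v) S" for v
  proof (rule Suc.IH)
    fix x assume "x \<in> S"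
    from Suc.prems[OF this]
    show "\<exists>U. open U \<and> x \<in> U \<and> Ck_on k (\<lambda>x. frechet_derivative f (at x) v) U" by auto
  qed
  ultimately show ?case
    by (auto simp: differentiable_on_def intro: differentiable_at_withinI)
qed

lemma Ck_on_SucD: "Ck_on (Suc k) f S \<Longrightarrow> Ck_on k f S"
  by (induction k arbitrary: f) (auto intro: differentiable_imp_continuous_on)

lemma Ck_on_const: "Ck_on k (\<lambda>x. a) S"
  by (induction k arbitrary: a) (auto simp: frechet_derivative_const)

lemma Ck_on_linear:
  assumes "bounded_linear L"
  shows "Ck_on k L S"
proof (cases k)
  case 0
  then show ?thesis using assms by (simp add: linear_continuous_on)
next
  case (Suc j)
  have "frechet_derivative L (at x) = L" for x
    using frechet_derivative_at[OF bounded_linear_imp_has_derivative[OF assms]] by simp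
  then show ?thesis
    using Suc assms by (auto simp: Ck_on_const bounded_linear_imp_differentiable_on)
qed

lemma Ck_on_add:
  assumes "open S" "Ck_on k f S" "Ck_on k g S"
  shows "Ck_on k (\<lambda>x. f x + g x) S"
  using assms(2,3)
proof (induction k arbitrary: f g)
  case 0
  then show ?case by (auto intro: continuous_on_add)
next
  case (Suc k)
  show ?case
    by (rule Ck_on_SucI[OF assms(1) has_derivative_add[OF Ck_on_has_derivative Ck_on_has_derivative]])
      (use Suc assms(1) in auto)
qed

lemma Ck_on_bilinear:
  assumes "bounded_bilinear B" "open S" "Ck_on k f S" "Ck_on k g S"
  shows "Ck_on k (\<lambda>x. B (f x) (g x)) S"
  using assms(3,4)
proof (induction k arbitrary: f g)
  case 0
  then show ?case using bounded_bilinear.continuous_on[OF assms(1)] by auto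
next
  case (Suc k)
  have "Ck_on k (\<lambda>x. B (f x) (frechet_derivative g (at x) v) + B (frechet_derivative f (at x) v) (g x)) S" for v
    using Suc.prems Suc.prems[THEN Ck_on_SucD] by (intro Ck_on_add[OF assms(2)] Suc.IH) auto
  then show ?case
    by (intro Ck_on_SucI[OF assms(2) bounded_bilinear.FDERIV[OF assms(1) Ck_on_has_derivative Ck_on_has_derivative]])
      (use Suc.prems assms(2) in auto)
qed

lemma Ck_on_linear_image:
  assumes "bounded_linear L" "open S" "Ck_on k f S"
  shows "Ck_on k (\<lambda>x. L (f x)) S"
  using assms(3)
proof (induction k arbitrary: f)
  case 0
  then show ?case using bounded_linear.continuous_on[OF assms(1)] by auto
next
  case (Suc k)
  show ?case
    by (rule Ck_on_SucI[OF assms(2) bounded_linear.has_derivative[OF assms(1) Ck_on_has_derivative]])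
      (use Suc assms(2) in auto)
qed

lemma Ck_on_sum:
  assumes "open S" "\<And>i. i \<in> I \<Longrightarrow> Ck_on k (f i) S"
  shows "Ck_on k (\<lambda>x. \<Sum>i\<in>I. f i x) S"
  using assms(2)
  by (induction I rule: infinite_finite_induct) (auto intro: Ck_on_const Ck_on_add[OF assms(1)])

lemma Ck_on_compose:
  fixes f :: "'b::euclidean_space \<Rightarrow> 'c::real_normed_vector" and g :: "'a::euclidean_space \<Rightarrow> 'b"
  assumes "open S" "open T" "g ` S \<subseteq> T" "Ck_on k f T" "Ck_on k g S"
  shows "Ck_on k (\<lambda>x. f (g x)) S"
  using assms(4,5)
proof (induction k arbitrary: f)
  case 0
  then show ?case using assms(3) continuous_on_compose2 by fastforce
next
  case (Suc k)
  have gS: "g x \<in> T" if "x \<in> S" for x using that assms(3) by auto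
  have der: "((\<lambda>x. f (g x)) has_derivative
      (\<lambda>v. frechet_derivative f (at (g x)) (frechet_derivative g (at x) v))) (at x)"
    if "x \<in> S" for x
    using diff_chain_at[OF Ck_on_has_derivative[OF Suc.prems(2) assms(1) that]
      Ck_on_has_derivative[OF Suc.prems(1) assms(2) gS[OF that]]] by (simp add: o_def)
  \<comment> \<open>The induction hypothesis covers the derivative of \<open>f\<close> in a fixed
    direction only, while in the chain rule the direction varies with \<open>x\<close>. Expansion in
    the standard basis leaves fixed directions, with coefficients depending on
    \<open>x\<close>.\<close>
  have expand: "frechet_derivative f (at (g x)) w =
      (\<Sum>b\<in>Basis. (w \<bullet> b) *\<^sub>R frechet_derivative f (at (g x)) b)" if "x \<in> S" for x w
  proof -
    have "linear (frechet_derivative f (at (g x)))"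
      using Ck_on_differentiable_at[OF Suc.prems(1) assms(2) gS[OF that]]
      by (rule linear_frechet_derivative)
    from linear_sum[OF this, of "\<lambda>b. (w \<bullet> b) *\<^sub>R b" Basis]
    show ?thesis
      by (simp add: euclidean_representation linear_cmul[OF \<open>linear _\<close>])
  qed
  have "Ck_on k (\<lambda>x. \<Sum>b\<in>Basis. (frechet_derivative g (at x) v \<bullet> b) *\<^sub>R
      frechet_derivative f (at (g x)) b) S" for v
    using Suc.prems Ck_on_SucD[OF Suc.prems(2)]
    by (intro Ck_on_sum Ck_on_bilinear[OF bounded_bilinear_scaleR] Suc.IH assms(1)
      Ck_on_linear_image[OF bounded_linear_inner_left]) auto
  then have "Ck_on k (\<lambda>x. frechet_derivative f (at (g x)) (frechet_derivative g (at x) v)) S" for v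
    by (rule Ck_on_cong[OF assms(1)]) (use expand in auto)
  then show ?case
    using der by (intro Ck_on_SucI[OF assms(1)]) (auto simp: assms(1))
qed

text \<open>The derivative of \<open>inverse\<close> is again a product of copies of
  \<open>inverse\<close> and a constant, so the rule for bilinear maps closes the induction. The
  function is the coordinate change between the two charts of the sphere.\<close>

lemma Ck_on_inverse: "Ck_on k inverse (- {0::complex})"
proof (induction k)
  case 0
  then show ?case by (auto intro!: continuous_intros)
next
  case (Suc k)
  have op: "open (- {0::complex})" by auto
  have "Ck_on k (\<lambda>x. - (inverse x * v * inverse x)) (- {0::complex})" for v
    by (intro Ck_on_linear_image[OF bounded_linear_minus[OF bounded_linear_ident]] op
      Ck_on_bilinear[OF bounded_bilinear_mult] Ck_on_const Suc)
  then show ?case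
    by (intro Ck_on_SucI[OF op has_derivative_inverse']) auto
qed

section \<open>Smooth functions on open sets\<close>

lemma smooth_on_cong:
  assumes "open S" "smooth_on S f" "\<And>x. x \<in> S \<Longrightarrow> f x = g x"
  shows "smooth_on S g"
  using assms Ck_on_cong unfolding smooth_on_def by blast

lemma smooth_on_subset: "smooth_on S f \<Longrightarrow> T \<subseteq> S \<Longrightarrow> smooth_on T f"
  using Ck_on_subset unfolding smooth_on_def by blast

lemma smooth_on_local:
  assumes "\<And>x. x \<in> S \<Longrightarrow> \<exists>U. open U \<and> x \<in> U \<and> smooth_on U f"
  shows "smooth_on S f"
  using assms unfolding smooth_on_def by (meson Ck_on_local)

lemma smooth_on_differentiable_at:
  "smooth_on S f \<Longrightarrow> open S \<Longrightarrow> x \<in> S \<Longrightarrow> f differentiable (at x)"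
  using Ck_on_differentiable_at unfolding smooth_on_def by blast

lemma smooth_on_continuous_on: "smooth_on S f \<Longrightarrow> continuous_on S f"
  using Ck_on.simps(1) unfolding smooth_on_def by blast

lemma smooth_on_const: "smooth_on S (\<lambda>x. a)"
  by (simp add: smooth_on_def Ck_on_const)

lemma smooth_on_linear: "bounded_linear L \<Longrightarrow> smooth_on S L"
  by (simp add: smooth_on_def Ck_on_linear)

lemma smooth_on_add:
  "open S \<Longrightarrow> smooth_on S f \<Longrightarrow> smooth_on S g \<Longrightarrow> smooth_on S (\<lambda>x. f x + g x)"
  by (simp add: smooth_on_def Ck_on_add)

lemma smooth_on_linear_image:
  "bounded_linear L \<Longrightarrow> open S \<Longrightarrow> smooth_on S f \<Longrightarrow> smooth_on S (\<lambda>x. L (f x))"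
  by (simp add: smooth_on_def Ck_on_linear_image)

lemma smooth_on_minus: "open S \<Longrightarrow> smooth_on S f \<Longrightarrow> smooth_on S (\<lambda>x. - f x)"
  by (rule smooth_on_linear_image[OF bounded_linear_minus[OF bounded_linear_ident]])

lemma smooth_on_diff:
  "open S \<Longrightarrow> smooth_on S f \<Longrightarrow> smooth_on S g \<Longrightarrow> smooth_on S (\<lambda>x. f x - g x)"
  using smooth_on_add[of S f "\<lambda>x. - g x"] smooth_on_minus by auto

lemma smooth_on_mult:
  fixes f g :: "_ \<Rightarrow> 'a::real_normed_algebra"
  shows "open S \<Longrightarrow> smooth_on S f \<Longrightarrow> smooth_on S g \<Longrightarrow> smooth_on S (\<lambda>x. f x * g x)"
  by (simp add: smooth_on_def Ck_on_bilinear[OF bounded_bilinear_mult])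

lemma smooth_on_sum:
  "open S \<Longrightarrow> (\<And>i. i \<in> I \<Longrightarrow> smooth_on S (f i)) \<Longrightarrow> smooth_on S (\<lambda>x. \<Sum>i\<in>I. f i x)"
  by (simp add: smooth_on_def Ck_on_sum)

lemma smooth_on_compose:
  assumes "open S" "open T" "g ` S \<subseteq> T" "smooth_on T f" "smooth_on S g"
  shows "smooth_on S (\<lambda>x. f (g x))"
  using assms Ck_on_compose unfolding smooth_on_def by blast

lemma smooth_on_Pair:
  assumes "open S" "smooth_on S f" "smooth_on S g"
  shows "smooth_on S (\<lambda>x. (f x, g x))"
proof -
  have "smooth_on S (\<lambda>x. (f x, 0) + (0, g x))"
    by (intro smooth_on_add[OF assms(1)] smooth_on_linear_image[OF _ assms(1) assms(2)]
        smooth_on_linear_image[OF _ assms(1) assms(3)] bounded_linear_Pair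
        bounded_linear_ident bounded_linear_zero)
  then show ?thesis by simp
qed

lemma bounded_linear_axis: "bounded_linear (axis k :: 'b::euclidean_space \<Rightarrow> 'b ^ 'n)"
  by (intro linear_conv_bounded_linear[THEN iffD1] linearI) (auto simp: axis_def vec_eq_iff)

text \<open>Displays a vector as a sum of linear images of its components, so that derivatives and
  smoothness pass to vectors through the rules for sums and linear maps.\<close>

lemma vec_lambda_sum_axis: "(\<chi> k. f k) = (\<Sum>k\<in>UNIV. axis k (f k))"
  by (simp add: vec_eq_iff axis_def)

lemma has_derivative_vec_lambda:
  fixes f :: "'n::finite \<Rightarrow> 'a::real_normed_vector \<Rightarrow> 'b::euclidean_space"
  assumes "\<And>k. (f k has_derivative f' k) F"
  shows "((\<lambda>x. \<chi> k. f k x) has_derivative (\<lambda>u. \<chi> k. f' k u)) F"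
  unfolding vec_lambda_sum_axis
  by (rule has_derivative_sum) (rule bounded_linear.has_derivative[OF bounded_linear_axis assms])

lemma smooth_on_vec_lambda:
  fixes f :: "'n::finite \<Rightarrow> 'a::euclidean_space \<Rightarrow> 'b::euclidean_space"
  assumes "open S" "\<And>k. smooth_on S (f k)"
  shows "smooth_on S (\<lambda>x. \<chi> k. f k x)"
  unfolding vec_lambda_sum_axis
  by (rule smooth_on_sum[OF assms(1)]) (rule smooth_on_linear_image[OF bounded_linear_axis assms])

section \<open>Charts, tangent spaces and differentials\<close>

lemma smooth_atlasD:
  assumes "smooth_atlas A" "c \<in> A"
  shows "inj_on (snd c) (fst c)" "open (snd c ` fst c)"
  using assms by (auto simp: smooth_atlas_def)

lemma smooth_atlas_transition:
  assumes "smooth_atlas A" "c \<in> A" "d \<in> A"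
  shows "open (snd c ` (fst c \<inter> fst d))"
    and "smooth_on (snd c ` (fst c \<inter> fst d)) (snd d \<circ> chart_inv c)"
  using assms by (auto simp: smooth_atlas_def)

lemma chart_inv_chart [simp]:
  "inj_on (snd c) (fst c) \<Longrightarrow> x \<in> fst c \<Longrightarrow> chart_inv c (snd c x) = x"
  by (simp add: chart_inv_def)

lemma chart_inv_atlas:
  "smooth_atlas A \<Longrightarrow> c \<in> A \<Longrightarrow> x \<in> fst c \<Longrightarrow> chart_inv c (snd c x) = x"
  by (rule chart_inv_chart[OF smooth_atlasD(1)])

lemma points_iff: "x \<in> points A \<longleftrightarrow> (\<exists>c\<in>A. x \<in> fst c)"
  by (auto simp: points_def)

lemma chart_points: "c \<in> A \<Longrightarrow> x \<in> fst c \<Longrightarrow> x \<in> points A"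
  by (auto simp: points_def)

lemma transition_differentiable:
  assumes "smooth_atlas A" "c \<in> A" "d \<in> A" "x \<in> fst c" "x \<in> fst d"
  shows "(snd d \<circ> chart_inv c) differentiable (at (snd c x))"
  using smooth_on_differentiable_at[OF smooth_atlas_transition(2,1)[OF assms(1-3)]] assms(4,5) by blast

text \<open>The chain rule with the transition map. The two composites need not agree off the
  overlap of the charts, so the derivative is transferred on the open image of the overlap.\<close>

lemma chart_change_has_derivative:
  assumes "smooth_atlas A" "c \<in> A" "d \<in> A" "x \<in> fst c" "x \<in> fst d"
    and "((f \<circ> chart_inv d) has_derivative f') (at (snd d x))"
  shows "((f \<circ> chart_inv c) has_derivative
    (\<lambda>u. f' (frechet_derivative (snd d \<circ> chart_inv c) (at (snd c x)) u))) (at (snd c x))"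
proof -
  have "((snd d \<circ> chart_inv c) has_derivative
      frechet_derivative (snd d \<circ> chart_inv c) (at (snd c x))) (at (snd c x))"
    using transition_differentiable[OF assms(1-5)] frechet_derivative_works by blast
  from diff_chain_at[OF this] assms(6)
  have "(((f \<circ> chart_inv d) \<circ> (snd d \<circ> chart_inv c)) has_derivative
    (f' \<circ> frechet_derivative (snd d \<circ> chart_inv c) (at (snd c x)))) (at (snd c x))"
    using assms by (simp add: chart_inv_atlas)
  then show ?thesis
    unfolding o_def[of f']
    by (rule has_derivative_transform_within_open[OF _ smooth_atlas_transition(1)[OF assms(1-3)]])
      (use assms in \<open>auto simp: chart_inv_atlas\<close>)
qed

section \<open>Tangent vectors as families of coordinate vectors\<close>

lemma scaleR_fun_apply: "(r *\<^sub>R f) x = r *\<^sub>R f x"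
  by (simp add: scaleR_fun_def)

lemma tangent_spaceD:
  assumes "\<xi> \<in> tangent_space A x" "c \<in> A" "d \<in> A" "x \<in> fst c" "x \<in> fst d"
  shows "\<xi> d = frechet_derivative (snd d \<circ> chart_inv c) (at (snd c x)) (\<xi> c)"
  using assms unfolding tangent_space_def by blast

lemma tangent_space_zero:
  "\<xi> \<in> tangent_space A x \<Longrightarrow> \<not> (c \<in> A \<and> x \<in> fst c) \<Longrightarrow> \<xi> c = 0"
  unfolding tangent_space_def by blast

lemma tangent_spaceI:
  assumes "\<And>c d. c \<in> A \<Longrightarrow> d \<in> A \<Longrightarrow> x \<in> fst c \<Longrightarrow> x \<in> fst d \<Longrightarrow>
      \<xi> d = frechet_derivative (snd d \<circ> chart_inv c) (at (snd c x)) (\<xi> c)"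
    and "\<And>c. \<not> (c \<in> A \<and> x \<in> fst c) \<Longrightarrow> \<xi> c = 0"
  shows "\<xi> \<in> tangent_space A x"
  using assms unfolding tangent_space_def by blast

text \<open>The Jacobians propagate one coordinate vector to all charts around \<open>x\<close>, and
  the default value zero settles the others. On the sphere this reduces identities of tangent
  vectors to a single stereographic chart.\<close>

lemma tangent_space_eqI:
  assumes "\<xi> \<in> tangent_space A x" "\<eta> \<in> tangent_space A x"
    and "c \<in> A" "x \<in> fst c" "\<xi> c = \<eta> c"
  shows "\<xi> = \<eta>"
proof
  fix d show "\<xi> d = \<eta> d"
    using tangent_spaceD[of \<xi> A x c d] tangent_spaceD[of \<eta> A x c d]
      tangent_space_zero[of \<xi> A x d] tangent_space_zero[of \<eta> A x d] assms
    by metis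
qed

lemma subspace_tangent_space:
  assumes "smooth_atlas A"
  shows "subspace (tangent_space A x)"
proof -
  have lin: "linear (frechet_derivative (snd d \<circ> chart_inv c) (at (snd c x)))"
    if "c \<in> A" "d \<in> A" "x \<in> fst c" "x \<in> fst d" for c d
    using transition_differentiable[OF assms that] by (rule linear_frechet_derivative)
  show ?thesis
  proof (rule subspaceI)
    show "0 \<in> tangent_space A x"
      by (rule tangent_spaceI) (simp_all add: linear_0[OF lin])
  next
    fix \<xi> \<eta> assume *: "\<xi> \<in> tangent_space A x" "\<eta> \<in> tangent_space A x"
    show "\<xi> + \<eta> \<in> tangent_space A x"
    proof (rule tangent_spaceI)
      fix c d assume "c \<in> A" "d \<in> A" "x \<in> fst c" "x \<in> fst d"
      then show "(\<xi> + \<eta>) d = frechet_derivative (snd d \<circ> chart_inv c) (at (snd c x)) ((\<xi> + \<eta>) c)"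
        using tangent_spaceD[OF *(1), of c d] tangent_spaceD[OF *(2), of c d] by (simp add: linear_add[OF lin])
    qed (use tangent_space_zero[OF *(1)] tangent_space_zero[OF *(2)] in auto)
  next
    fix r \<xi> assume *: "\<xi> \<in> tangent_space A x"
    show "r *\<^sub>R \<xi> \<in> tangent_space A x"
    proof (rule tangent_spaceI)
      fix c d assume "c \<in> A" "d \<in> A" "x \<in> fst c" "x \<in> fst d"
      then show "(r *\<^sub>R \<xi>) d = frechet_derivative (snd d \<circ> chart_inv c) (at (snd c x)) ((r *\<^sub>R \<xi>) c)"
        using tangent_spaceD[OF *, of c d] by (simp add: scaleR_fun_def linear_cmul[OF lin])
    qed (use tangent_space_zero[OF *] in \<open>auto simp: scaleR_fun_def\<close>)
  qed
qed

lemma linear_coord_vector: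
  assumes "smooth_atlas A" "c \<in> A" "x \<in> fst c"
  shows "linear (coord_vector A c x)"
proof -
  have lin: "linear (frechet_derivative (snd d \<circ> chart_inv c) (at (snd c x)))"
    if "d \<in> A" "x \<in> fst d" for d
    using transition_differentiable[OF assms(1,2) that(1) assms(3) that(2)]
    by (rule linear_frechet_derivative)
  show ?thesis
  proof (rule linearI)
    fix u v
    show "coord_vector A c x (u + v) = coord_vector A c x u + coord_vector A c x v"
    proof
      fix d show "coord_vector A c x (u + v) d = (coord_vector A c x u + coord_vector A c x v) d"
        using linear_add[OF lin, of d u v] by (cases "d \<in> A \<and> x \<in> fst d") (auto simp: coord_vector_def)
    qed
  next
    fix r u
    show "coord_vector A c x (r *\<^sub>R u) = r *\<^sub>R coord_vector A c x u"
    proof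
      fix d show "coord_vector A c x (r *\<^sub>R u) d = (r *\<^sub>R coord_vector A c x u) d"
        using linear_cmul[OF lin, of d r u]
        by (cases "d \<in> A \<and> x \<in> fst d") (auto simp: coord_vector_def scaleR_fun_def)
    qed
  qed
qed

lemma chart_self_has_derivative:
  assumes "smooth_atlas A" "c \<in> A" "x \<in> fst c"
  shows "((snd c \<circ> chart_inv c) has_derivative (\<lambda>u. u)) (at (snd c x))"
  by (rule has_derivative_transform_within_open[OF has_derivative_ident smooth_atlasD(2)[OF assms(1,2)]])
    (use assms in \<open>auto simp: chart_inv_atlas\<close>)

lemma coord_vector_apply:
  assumes "smooth_atlas A" "c \<in> A" "x \<in> fst c"
  shows "coord_vector A c x u c = u"
  using assms by (simp add: coord_vector_def frechet_derivative_at[OF chart_self_has_derivative[OF assms], symmetric])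

text \<open>By the chain rule the Jacobians of the coordinate changes satisfy a cocycle identity,
  which is exactly the compatibility required of a tangent vector.\<close>

lemma coord_vector_tangent:
  assumes "smooth_atlas A" "c \<in> A" "x \<in> fst c"
  shows "coord_vector A c x u \<in> tangent_space A x"
proof -
  have cv: "coord_vector A c x u d = frechet_derivative (snd d \<circ> chart_inv c) (at (snd c x)) u"
    if "d \<in> A" "x \<in> fst d" for d
    using that by (simp add: coord_vector_def)
  have *: "coord_vector A c x u d' =
      frechet_derivative (snd d' \<circ> chart_inv d) (at (snd d x))
        (coord_vector A c x u d)"
    if "d \<in> A" "d' \<in> A" "x \<in> fst d" "x \<in> fst d'" for d d'
  proof -
    have "((snd d' \<circ> chart_inv d) has_derivative
        frechet_derivative (snd d' \<circ> chart_inv d) (at (snd d x))) (at (snd d x))"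
      using transition_differentiable[OF assms(1) that] frechet_derivative_works by blast
    from frechet_derivative_at[OF chart_change_has_derivative[OF assms(1,2) that(1) assms(3) that(3) this]]
    show ?thesis using cv[of d] cv[of d'] that by metis
  qed
  show ?thesis
    by (rule tangent_spaceI) (erule (3) *, auto simp: coord_vector_def)
qed

lemma range_coord_vector:
  assumes "smooth_atlas A" "c \<in> A" "x \<in> fst c"
  shows "range (coord_vector A c x) = tangent_space A x"
proof (intro equalityI subsetI)
  fix \<xi> assume "\<xi> \<in> tangent_space A x"
  then have "\<xi> = coord_vector A c x (\<xi> c)"
    by (rule tangent_space_eqI[OF _ coord_vector_tangent[OF assms] assms(2,3)])
      (simp add: coord_vector_apply[OF assms])
  then show "\<xi> \<in> range (coord_vector A c x)" by blast
qed (use coord_vector_tangent[OF assms] in auto)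

text \<open>The images of the standard basis under \<open>coord_vector\<close>. They are indexed by
  the type \<open>'n\<close> itself, the form in which the charts of \<open>nO2_atlas\<close> take a
  basis of the Lie algebra.\<close>

lemma tangent_space_basis:
  fixes A :: "('m, real^'n) chart set"
  assumes "smooth_atlas A" "x \<in> points A"
  obtains b :: "'n \<Rightarrow> ('m, real^'n) tangent"
  where "inj b" "independent (range b)" "span (range b) = tangent_space A x"
proof -
  obtain c where c: "c \<in> A" "x \<in> fst c" using assms(2) by (auto simp: points_iff)
  let ?L = "coord_vector A c x"
  have L: "linear ?L" by (rule linear_coord_vector[OF assms(1) c])
  have inj: "inj ?L" by (metis coord_vector_apply[OF assms(1) c] injI)
  have ax: "range (\<lambda>k. axis k 1) = (Basis :: (real^'n) set)"
    by (auto simp: Basis_vec_def)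
  have rng: "range (\<lambda>k. ?L (axis k 1)) = ?L ` Basis"
    unfolding ax[symmetric] by auto
  show ?thesis
  proof
    show "inj (\<lambda>k. ?L (axis k 1))"
      by (rule injI) (use injD[OF inj] in \<open>force simp: axis_eq_axis\<close>)
    show "independent (range (\<lambda>k. ?L (axis k 1)))"
      unfolding rng by (rule linear_independent_injective_image[OF L independent_Basis])
        (use inj in \<open>auto intro: inj_on_subset\<close>)
    show "span (range (\<lambda>k. ?L (axis k 1))) = tangent_space A x"
      unfolding rng linear_span_image[OF L] span_Basis by (rule range_coord_vector[OF assms(1) c])
  qed
qed

text \<open>\<open>differential_fun\<close> selects its chart with \<open>SOME\<close>. By the chain
  rule every chart around the point gives the same value, so that computations may use a convenient
  one.\<close>

lemma differential_fun_eq: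
  assumes "smooth_atlas A" "c \<in> A" "x \<in> fst c" "\<xi> \<in> tangent_space A x"
    and "((f \<circ> chart_inv c) has_derivative f') (at (snd c x))"
  shows "differential_fun A f x \<xi> = f' (\<xi> c)"
proof -
  define d where "d = (SOME d. d \<in> A \<and> x \<in> fst d)"
  have d: "d \<in> A" "x \<in> fst d"
    using someI[of "\<lambda>d. d \<in> A \<and> x \<in> fst d" c] assms(2,3) by (auto simp: d_def)
  have "differential_fun A f x \<xi> = frechet_derivative (f \<circ> chart_inv d) (at (snd d x)) (\<xi> d)"
    by (simp add: differential_fun_def d_def Let_def)
  also have "\<dots> = f' (frechet_derivative (snd c \<circ> chart_inv d) (at (snd d x)) (\<xi> d))"
    using frechet_derivative_at[OF chart_change_has_derivative[OF assms(1) d(1) assms(2) d(2) assms(3) assms(5)]]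
    by metis
  also have "\<dots> = f' (\<xi> c)"
    using tangent_spaceD[OF assms(4) d(1) assms(2) d(2) assms(3)] by simp
  finally show ?thesis .
qed

lemma smooth_function_differentiable:
  assumes "smooth_atlas A" "smooth_function A f" "c \<in> A" "x \<in> fst c"
  shows "((f \<circ> chart_inv c) has_derivative frechet_derivative (f \<circ> chart_inv c) (at (snd c x))) (at (snd c x))"
  using smooth_on_differentiable_at[of "snd c ` fst c" "f \<circ> chart_inv c" "snd c x"] assms smooth_atlasD(2)
    frechet_derivative_works unfolding smooth_function_def by blast

lemma smooth_map_points: "smooth_map A B F \<Longrightarrow> x \<in> points A \<Longrightarrow> F x \<in> points B"
  by (auto simp: smooth_map_def)

lemma smooth_map_open:
  "smooth_map A B F \<Longrightarrow> c \<in> A \<Longrightarrow> d \<in> B \<Longrightarrow> open (snd c ` {x\<in>fst c. F x \<in> fst d})"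
  by (auto simp: smooth_map_def)

lemma smooth_map_smooth_on:
  "smooth_map A B F \<Longrightarrow> c \<in> A \<Longrightarrow> d \<in> B \<Longrightarrow>
    smooth_on (snd c ` {x\<in>fst c. F x \<in> fst d}) (snd d \<circ> F \<circ> chart_inv c)"
  by (auto simp: smooth_map_def)

lemma smooth_map_has_derivative:
  assumes "smooth_map A B F" "c \<in> A" "d \<in> B" "x \<in> fst c" "F x \<in> fst d"
  shows "((snd d \<circ> F \<circ> chart_inv c) has_derivative
    frechet_derivative (snd d \<circ> F \<circ> chart_inv c) (at (snd c x))) (at (snd c x))"
  using smooth_on_differentiable_at[OF smooth_map_smooth_on[OF assms(1-3)] smooth_map_open[OF assms(1-3)]]
    assms(4,5) frechet_derivative_works by blast

lemma differential_apply:
  assumes "smooth_atlas A" "smooth_map A B F" "c \<in> A" "d \<in> B" "x \<in> fst c" "F x \<in> fst d"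
    and "\<xi> \<in> tangent_space A x"
  shows "differential A B F x \<xi> d =
    frechet_derivative (snd d \<circ> F \<circ> chart_inv c) (at (snd c x)) (\<xi> c)"
  using differential_fun_eq[OF assms(1,3,5,7) smooth_map_has_derivative[OF assms(2-6)]] assms(4,6)
  by (simp add: differential_def)

lemma compose_chart_has_derivative:
  assumes "smooth_atlas A" "smooth_atlas B" "smooth_map A B F"
    and "c \<in> A" "d \<in> B" "x \<in> fst c" "F x \<in> fst d"
    and "((h \<circ> chart_inv d) has_derivative h') (at (snd d (F x)))"
  shows "((h \<circ> F \<circ> chart_inv c) has_derivative
    (\<lambda>u. h' (frechet_derivative (snd d \<circ> F \<circ> chart_inv c) (at (snd c x)) u))) (at (snd c x))"
proof -
  from diff_chain_at[OF smooth_map_has_derivative[OF assms(3-7)]] assms(8)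
  have "(((h \<circ> chart_inv d) \<circ> (snd d \<circ> F \<circ> chart_inv c)) has_derivative
    (h' \<circ> frechet_derivative (snd d \<circ> F \<circ> chart_inv c) (at (snd c x)))) (at (snd c x))"
    using assms by (simp add: chart_inv_atlas)
  then show ?thesis
    unfolding o_def[of h']
    by (rule has_derivative_transform_within_open[OF _ smooth_map_open[OF assms(3-5)]])
      (use assms in \<open>auto simp: chart_inv_atlas\<close>)
qed

lemma differential_tangent:
  assumes "smooth_atlas A" "smooth_atlas B" "smooth_map A B F" "x \<in> points A"
    and "\<xi> \<in> tangent_space A x"
  shows "differential A B F x \<xi> \<in> tangent_space B (F x)"
proof -
  obtain c where c: "c \<in> A" "x \<in> fst c" using assms(4) by (auto simp: points_iff)
  have *: "differential A B F x \<xi> d' =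
      frechet_derivative (snd d' \<circ> chart_inv d) (at (snd d (F x))) (differential A B F x \<xi> d)"
    if d: "d \<in> B" "d' \<in> B" "F x \<in> fst d" "F x \<in> fst d'" for d d'
  proof -
    have "((snd d' \<circ> chart_inv d) has_derivative
        frechet_derivative (snd d' \<circ> chart_inv d) (at (snd d (F x)))) (at (snd d (F x)))"
      using transition_differentiable[OF assms(2) d] frechet_derivative_works by blast
    from frechet_derivative_at[OF compose_chart_has_derivative[OF assms(1-3) c(1) d(1) c(2) d(3) this]]
    show ?thesis
      using differential_apply[OF assms(1,3) c(1) d(1) c(2) d(3) assms(5)]
        differential_apply[OF assms(1,3) c(1) d(2) c(2) d(4) assms(5)] by metis
  qed
  show ?thesis
    by (rule tangent_spaceI) (erule (3) *, auto simp: differential_def)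
qed

text \<open>Only a derivative of \<open>h\<close> in one chart is required. So \<open>h\<close> may
  be a coordinate map, meaningful on part of the manifold only, as in
  \<open>differential_chain\<close>, or a global function.\<close>

lemma differential_fun_chain:
  assumes "smooth_atlas A" "smooth_atlas B" "smooth_map A B F"
    and "x \<in> points A" "\<xi> \<in> tangent_space A x" "d \<in> B" "F x \<in> fst d"
    and "((h \<circ> chart_inv d) has_derivative h') (at (snd d (F x)))"
  shows "differential_fun A (h \<circ> F) x \<xi> = differential_fun B h (F x) (differential A B F x \<xi>)"
proof -
  obtain c where c: "c \<in> A" "x \<in> fst c" using assms(4) by (auto simp: points_iff)
  show ?thesis
    using differential_fun_eq[OF assms(1) c assms(5)
        compose_chart_has_derivative[OF assms(1-3) c(1) assms(6) c(2) assms(7,8)]]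
      differential_fun_eq[OF assms(2) assms(6,7) differential_tangent[OF assms(1-5)] assms(8)]
      differential_apply[OF assms(1,3) c(1) assms(6) c(2) assms(7) assms(5)] by simp
qed

lemma differential_chain:
  assumes "smooth_atlas A" "smooth_atlas B" "smooth_map A B F" "smooth_map B D G"
    and "x \<in> points A" "\<xi> \<in> tangent_space A x"
  shows "differential A D (\<lambda>y. G (F y)) x \<xi> = differential B D G (F x) (differential A B F x \<xi>)"
proof
  fix d
  obtain e where e: "e \<in> B" "F x \<in> fst e"
    using smooth_map_points[OF assms(3,5)] by (auto simp: points_iff)
  show "differential A D (\<lambda>y. G (F y)) x \<xi> d = differential B D G (F x) (differential A B F x \<xi>) d"
    using differential_fun_chain[OF assms(1-3,5,6) e smooth_map_has_derivative[OF assms(4) e(1) _ e(2)], of d]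
    by (simp add: differential_def o_def)
qed

lemma differential_add:
  assumes "smooth_atlas A" "smooth_map A B F" "x \<in> points A"
    and "\<xi> \<in> tangent_space A x" "\<eta> \<in> tangent_space A x"
  shows "differential A B F x (\<xi> + \<eta>) = differential A B F x \<xi> + differential A B F x \<eta>"
proof
  fix d
  obtain c where c: "c \<in> A" "x \<in> fst c" using assms(3) by (auto simp: points_iff)
  show "differential A B F x (\<xi> + \<eta>) d = (differential A B F x \<xi> + differential A B F x \<eta>) d"
  proof (cases "d \<in> B \<and> F x \<in> fst d")
    case True
    then have d: "d \<in> B" "F x \<in> fst d" by auto
    have "\<xi> + \<eta> \<in> tangent_space A x"
      using subspace_add[OF subspace_tangent_space[OF assms(1)]] assms(4,5) by blast
    then show ?thesis
      using differential_apply[OF assms(1,2) c(1) d(1) c(2) d(2)] assms(4,5)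
        linear_add[OF has_derivative_linear[OF smooth_map_has_derivative[OF assms(2) c(1) d(1) c(2) d(2)]]]
      by simp
  next
    case False
    then show ?thesis by (auto simp: differential_def)
  qed
qed

lemma differential_fun_chart:
  assumes "smooth_atlas A" "c \<in> A" "x \<in> fst c" "\<xi> \<in> tangent_space A x"
  shows "differential_fun A (snd c) x \<xi> = \<xi> c"
  using differential_fun_eq[OF assms chart_self_has_derivative[OF assms(1-3)]] .

lemma differential_ident:
  assumes "smooth_atlas A" "\<xi> \<in> tangent_space A x"
  shows "differential A A (\<lambda>y. y) x \<xi> = \<xi>"
  using differential_fun_chart[OF assms(1) _ _ assms(2)] tangent_space_zero[OF assms(2)]
  by (auto simp: differential_def fun_eq_iff o_def)

lemma differential_fun_const: "differential_fun A (\<lambda>x. a) x \<xi> = 0"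
  by (simp add: differential_fun_def o_def Let_def frechet_derivative_const)

lemma differential_const: "differential A B (\<lambda>y. b) x \<xi> = 0"
  by (simp add: differential_def differential_fun_def fun_eq_iff o_def Let_def frechet_derivative_const)

lemma smooth_map_ident:
  assumes "smooth_atlas A"
  shows "smooth_map A A (\<lambda>x. x)"
proof -
  have "{x\<in>fst c. x \<in> fst d} = fst c \<inter> fst d" for c d :: "('a, 'b) chart" by auto
  moreover have "snd d \<circ> (\<lambda>x. x) \<circ> chart_inv c = snd d \<circ> chart_inv c" for c d :: "('a, 'b) chart"
    by (simp add: fun_eq_iff)
  ultimately show ?thesis
    using smooth_atlas_transition[OF assms] by (simp add: smooth_map_def)
qed

lemma smooth_function_vec_lambda:
  fixes f :: "'n::finite \<Rightarrow> 'm \<Rightarrow> real"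
  assumes "smooth_atlas A" "\<And>k. smooth_function A (f k)"
  shows "smooth_function A (\<lambda>x. \<chi> k. f k x)"
  unfolding smooth_function_def
proof
  fix c assume c: "c \<in> A"
  have "smooth_on (snd c ` fst c) (f k \<circ> chart_inv c)" for k
    using assms(2)[of k] c unfolding smooth_function_def by blast
  then have "smooth_on (snd c ` fst c) (\<lambda>y. \<chi> k. (f k \<circ> chart_inv c) y)"
    by (rule smooth_on_vec_lambda[OF smooth_atlasD(2)[OF assms(1) c]])
  then show "smooth_on (snd c ` fst c) ((\<lambda>x. \<chi> k. f k x) \<circ> chart_inv c)"
    by (simp add: o_def)
qed

lemma differential_fun_vec_lambda:
  fixes f :: "'n::finite \<Rightarrow> 'm \<Rightarrow> real"
  assumes "smooth_atlas A" "\<And>k. smooth_function A (f k)" "x \<in> points A" "\<xi> \<in> tangent_space A x"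
  shows "differential_fun A (\<lambda>x. \<chi> k. f k x) x \<xi> = (\<chi> k. differential_fun A (f k) x \<xi>)"
proof -
  obtain c where c: "c \<in> A" "x \<in> fst c" using assms(3) by (auto simp: points_iff)
  note d = smooth_function_differentiable[OF assms(1) assms(2) c]
  have "(((\<lambda>x. \<chi> k. f k x) \<circ> chart_inv c) has_derivative
      (\<lambda>u. \<chi> k. frechet_derivative (f k \<circ> chart_inv c) (at (snd c x)) u)) (at (snd c x))"
    using has_derivative_vec_lambda[OF d] by (simp add: o_def)
  from differential_fun_eq[OF assms(1) c assms(4) this]
  show ?thesis
    using differential_fun_eq[OF assms(1) c assms(4) d] by simp
qed

lemma smooth_map_compose:
  assumes "smooth_atlas A" "smooth_atlas B" "smooth_map A B F" "smooth_map B D G"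
  shows "smooth_map A D (\<lambda>x. G (F x))"
proof -
  have "open (snd c ` {x\<in>fst c. G (F x) \<in> fst d}) \<and>
      smooth_on (snd c ` {x\<in>fst c. G (F x) \<in> fst d}) (snd d \<circ> (\<lambda>x. G (F x)) \<circ> chart_inv c)"
    if c: "c \<in> A" and d: "d \<in> D" for c d
  proof -
    \<comment> \<open>The set \<open>E\<close> will be the domain of a chart of the middle manifold.
      No single such chart need contain all values of \<open>F\<close>, so smoothness is proved on
      each \<open>U (fst e)\<close> separately and then glued.\<close>
    define U where "U = (\<lambda>E. snd c ` {x\<in>fst c. F x \<in> E \<and> G (F x) \<in> fst d})"
    have inv: "chart_inv c (snd c x) = x" if "x \<in> fst c" for x
      using chart_inv_atlas[OF assms(1) c that] .
    have U: "open (U (fst e)) \<and> smooth_on (U (fst e)) (snd d \<circ> (\<lambda>x. G (F x)) \<circ> chart_inv c)" if e: "e \<in> B" for e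
    proof -
      let ?S = "snd c ` {x\<in>fst c. F x \<in> fst e}" and ?T = "snd e ` {y\<in>fst e. G y \<in> fst d}"
      let ?h = "snd e \<circ> F \<circ> chart_inv c"
      have S: "open ?S" "smooth_on ?S ?h"
        using smooth_map_open[OF assms(3) c e] smooth_map_smooth_on[OF assms(3) c e] by auto
      have T: "open ?T" "smooth_on ?T (snd d \<circ> G \<circ> chart_inv e)"
        using smooth_map_open[OF assms(4) e d] smooth_map_smooth_on[OF assms(4) e d] by auto
      have "U (fst e) = ?S \<inter> ?h -` ?T"
      proof (intro equalityI subsetI)
        fix y assume "y \<in> U (fst e)"
        then show "y \<in> ?S \<inter> ?h -` ?T" by (auto simp: U_def inv)
      next
        fix y assume "y \<in> ?S \<inter> ?h -` ?T"
        then obtain x p where x: "y = snd c x" "x \<in> fst c" "F x \<in> fst e"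
          and p: "snd e (F x) = snd e p" "p \<in> fst e" "G p \<in> fst d"
          by (auto simp: inv)
        then have "F x = p"
          using smooth_atlasD(1)[OF assms(2) e] by (auto dest: inj_onD)
        then show "y \<in> U (fst e)" using x p by (auto simp: U_def)
      qed
      moreover have "open (?S \<inter> ?h -` ?T)"
        by (rule continuous_open_preimage[OF smooth_on_continuous_on[OF S(2)] S(1) T(1)])
      ultimately have "open (U (fst e))" by simp
      moreover have "smooth_on (U (fst e)) (\<lambda>y. (snd d \<circ> G \<circ> chart_inv e) (?h y))"
        by (rule smooth_on_compose[OF \<open>open (U (fst e))\<close> T(1) _ T(2) smooth_on_subset[OF S(2)]])
          (auto simp: U_def inv)
      then have "smooth_on (U (fst e)) (snd d \<circ> (\<lambda>x. G (F x)) \<circ> chart_inv c)"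
        by (rule smooth_on_cong[OF \<open>open (U (fst e))\<close>])
          (auto simp: U_def inv chart_inv_atlas[OF assms(2) e])
      ultimately show ?thesis by blast
    qed
    have eq: "snd c ` {x\<in>fst c. G (F x) \<in> fst d} = (\<Union>e\<in>B. U (fst e))"
      using smooth_map_points[OF assms(3)] c by (fastforce simp: U_def points_iff)
    show ?thesis
      unfolding eq using U by (blast intro: smooth_on_local)
  qed
  then show ?thesis
    using smooth_map_points[OF assms(3)] smooth_map_points[OF assms(4)]
    by (auto simp: smooth_map_def)
qed

lemma smooth_function_compose:
  assumes "smooth_atlas A" "smooth_atlas B" "smooth_map A B F" "smooth_function B f"
  shows "smooth_function A (\<lambda>x. f (F x))"
  unfolding smooth_function_def
proof (intro ballI smooth_on_local)
  fix c y assume c: "c \<in> A" and y: "y \<in> snd c ` fst c"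
  then obtain x where x: "x \<in> fst c" "y = snd c x" by blast
  obtain e where e: "e \<in> B" "F x \<in> fst e"
    using smooth_map_points[OF assms(3)] c x by (meson chart_points points_iff)
  let ?S = "snd c ` {x\<in>fst c. F x \<in> fst e}" and ?h = "snd e \<circ> F \<circ> chart_inv c"
  have S: "open ?S" "smooth_on ?S ?h"
    using smooth_map_open[OF assms(3) c e(1)] smooth_map_smooth_on[OF assms(3) c e(1)] by auto
  have f: "smooth_on (snd e ` fst e) (f \<circ> chart_inv e)"
    using assms(4) e by (simp add: smooth_function_def)
  have "smooth_on ?S (\<lambda>y. (f \<circ> chart_inv e) (?h y))"
    by (rule smooth_on_compose[OF S(1) smooth_atlasD(2)[OF assms(2) e(1)] _ f S(2)])
      (auto simp: chart_inv_atlas[OF assms(1) c])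
  then have "smooth_on ?S ((\<lambda>x. f (F x)) \<circ> chart_inv c)"
    by (rule smooth_on_cong[OF S(1)])
      (use e c in \<open>auto simp: chart_inv_atlas[OF assms(1) c] chart_inv_atlas[OF assms(2) e(1)]\<close>)
  then show "\<exists>U. open U \<and> y \<in> U \<and> smooth_on U ((\<lambda>x. f (F x)) \<circ> chart_inv c)"
    using S(1) x e by blast
qed

section \<open>Products of manifolds\<close>

lemma points_prod_atlas: "points (prod_atlas A B) = points A \<times> points B"
  by (force simp: points_def prod_atlas_def)

lemma prod_atlasE:
  assumes "p \<in> prod_atlas A B"
  obtains c d where "c \<in> A" "d \<in> B" "p = (fst c \<times> fst d, map_prod (snd c) (snd d))"
  using assms by (auto simp: prod_atlas_def)

lemma map_prod_image_Times: "map_prod f g ` (S \<times> T) = (f ` S) \<times> (g ` T)"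
  by force

text \<open>Outside the image of the product chart the value of \<open>inv_into\<close> is arbitrary
  and need not split into components, hence the restriction on \<open>p\<close>.\<close>

lemma chart_inv_prod:
  assumes "inj_on (snd c) (fst c)" "inj_on (snd d) (fst d)"
    and "p \<in> snd c ` fst c \<times> snd d ` fst d"
  shows "chart_inv (fst c \<times> fst d, map_prod (snd c) (snd d)) p = (chart_inv c (fst p), chart_inv d (snd p))"
proof -
  let ?P = "(fst c \<times> fst d, map_prod (snd c) (snd d))"
  obtain x y where p: "p = (snd c x, snd d y)" "x \<in> fst c" "y \<in> fst d" using assms(3) by auto
  have "inj_on (snd ?P) (fst ?P)" using map_prod_inj_on[OF assms(1,2)] by simp
  from chart_inv_chart[OF this, of "(x, y)"] p show ?thesis
    using assms(1,2) by simp
qed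

lemma smooth_on_fst_comp:
  assumes "open S" "open T" "smooth_on S f"
  shows "smooth_on (S \<times> T) (\<lambda>p. f (fst p))"
  by (rule smooth_on_compose[OF open_Times[OF assms(1,2)] assms(1) _ assms(3) smooth_on_linear])
    (auto intro: bounded_linear_fst)

lemma smooth_on_snd_comp:
  assumes "open S" "open T" "smooth_on T f"
  shows "smooth_on (S \<times> T) (\<lambda>p. f (snd p))"
  by (rule smooth_on_compose[OF open_Times[OF assms(1,2)] assms(2) _ assms(3) smooth_on_linear])
    (auto intro: bounded_linear_snd)

lemma smooth_atlas_prod:
  assumes "smooth_atlas A" "smooth_atlas B"
  shows "smooth_atlas (prod_atlas A B)"
proof -
  have "inj_on (snd p) (fst p) \<and> open (snd p ` fst p)" if "p \<in> prod_atlas A B" for p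
    using that smooth_atlasD[OF assms(1)] smooth_atlasD[OF assms(2)]
    by (auto elim!: prod_atlasE simp: map_prod_image_Times intro!: map_prod_inj_on open_Times)
  moreover have "open (snd p ` (fst p \<inter> fst q)) \<and>
      smooth_on (snd p ` (fst p \<inter> fst q)) (snd q \<circ> chart_inv p)"
    if p: "p \<in> prod_atlas A B" and q: "q \<in> prod_atlas A B" for p q
  proof -
    obtain c d where c: "c \<in> A" "d \<in> B" "p = (fst c \<times> fst d, map_prod (snd c) (snd d))"
      using p by (rule prod_atlasE)
    obtain c' d' where c': "c' \<in> A" "d' \<in> B" "q = (fst c' \<times> fst d', map_prod (snd c') (snd d'))"
      using q by (rule prod_atlasE)
    let ?S = "snd c ` (fst c \<inter> fst c')" and ?T = "snd d ` (fst d \<inter> fst d')"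
    have eq: "snd p ` (fst p \<inter> fst q) = ?S \<times> ?T"
      using c c' by (simp add: Times_Int_Times map_prod_image_Times)
    have S: "open ?S" "open ?T" "open (?S \<times> ?T)"
      using smooth_atlas_transition(1)[OF assms(1) c(1) c'(1)]
        smooth_atlas_transition(1)[OF assms(2) c(2) c'(2)] by (simp_all add: open_Times)
    have "smooth_on (?S \<times> ?T) (\<lambda>p. ((snd c' \<circ> chart_inv c) (fst p), (snd d' \<circ> chart_inv d) (snd p)))"
      by (rule smooth_on_Pair[OF S(3) smooth_on_fst_comp[OF S(1,2)] smooth_on_snd_comp[OF S(1,2)]])
        (rule smooth_atlas_transition(2)[OF assms(1) c(1) c'(1)]
          smooth_atlas_transition(2)[OF assms(2) c(2) c'(2)])+
    then have "smooth_on (?S \<times> ?T) (snd q \<circ> chart_inv p)"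
      by (rule smooth_on_cong[OF S(3)])
        (use smooth_atlasD(1)[OF assms(1) c(1)] smooth_atlasD(1)[OF assms(2) c(2)] in
          \<open>auto simp: c(3) c'(3) chart_inv_prod\<close>)
    then show ?thesis using eq S by simp
  qed
  ultimately show ?thesis by (simp add: smooth_atlas_def)
qed

lemma smooth_map_fst:
  assumes "smooth_atlas A" "smooth_atlas B"
  shows "smooth_map (prod_atlas A B) A fst"
proof -
  have "open (snd p ` {z\<in>fst p. fst z \<in> fst e}) \<and>
      smooth_on (snd p ` {z\<in>fst p. fst z \<in> fst e}) (snd e \<circ> fst \<circ> chart_inv p)"
    if p: "p \<in> prod_atlas A B" and e: "e \<in> A" for p e
  proof -
    obtain c d where c: "c \<in> A" "d \<in> B" "p = (fst c \<times> fst d, map_prod (snd c) (snd d))"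
      using p by (rule prod_atlasE)
    let ?S = "snd c ` (fst c \<inter> fst e)" and ?T = "snd d ` fst d"
    have "{z\<in>fst p. fst z \<in> fst e} = (fst c \<inter> fst e) \<times> fst d" using c by auto
    then have eq: "snd p ` {z\<in>fst p. fst z \<in> fst e} = ?S \<times> ?T"
      using c by (simp add: map_prod_image_Times)
    have S: "open ?S" "open ?T" "open (?S \<times> ?T)"
      using smooth_atlas_transition(1)[OF assms(1) c(1) e] smooth_atlasD(2)[OF assms(2) c(2)]
      by (simp_all add: open_Times)
    have "smooth_on (?S \<times> ?T) (\<lambda>p. (snd e \<circ> chart_inv c) (fst p))"
      by (rule smooth_on_fst_comp[OF S(1,2) smooth_atlas_transition(2)[OF assms(1) c(1) e]])
    then have "smooth_on (?S \<times> ?T) (snd e \<circ> fst \<circ> chart_inv p)"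
      by (rule smooth_on_cong[OF S(3)])
        (use smooth_atlasD(1)[OF assms(1) c(1)] smooth_atlasD(1)[OF assms(2) c(2)] in
          \<open>auto simp: c(3) chart_inv_prod\<close>)
    then show ?thesis using eq S by simp
  qed
  then show ?thesis by (auto simp: smooth_map_def points_prod_atlas)
qed

lemma smooth_map_snd:
  assumes "smooth_atlas A" "smooth_atlas B"
  shows "smooth_map (prod_atlas A B) B snd"
proof -
  have "open (snd p ` {z\<in>fst p. snd z \<in> fst e}) \<and>
      smooth_on (snd p ` {z\<in>fst p. snd z \<in> fst e}) (snd e \<circ> snd \<circ> chart_inv p)"
    if p: "p \<in> prod_atlas A B" and e: "e \<in> B" for p e
  proof -
    obtain c d where c: "c \<in> A" "d \<in> B" "p = (fst c \<times> fst d, map_prod (snd c) (snd d))"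
      using p by (rule prod_atlasE)
    let ?S = "snd c ` fst c" and ?T = "snd d ` (fst d \<inter> fst e)"
    have "{z\<in>fst p. snd z \<in> fst e} = fst c \<times> (fst d \<inter> fst e)" using c by auto
    then have eq: "snd p ` {z\<in>fst p. snd z \<in> fst e} = ?S \<times> ?T"
      using c by (simp add: map_prod_image_Times)
    have S: "open ?S" "open ?T" "open (?S \<times> ?T)"
      using smooth_atlas_transition(1)[OF assms(2) c(2) e] smooth_atlasD(2)[OF assms(1) c(1)]
      by (simp_all add: open_Times)
    have "smooth_on (?S \<times> ?T) (\<lambda>p. (snd e \<circ> chart_inv d) (snd p))"
      by (rule smooth_on_snd_comp[OF S(1,2) smooth_atlas_transition(2)[OF assms(2) c(2) e]])
    then have "smooth_on (?S \<times> ?T) (snd e \<circ> snd \<circ> chart_inv p)"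
      by (rule smooth_on_cong[OF S(3)])
        (use smooth_atlasD(1)[OF assms(1) c(1)] smooth_atlasD(1)[OF assms(2) c(2)] in
          \<open>auto simp: c(3) chart_inv_prod\<close>)
    then show ?thesis using eq S by simp
  qed
  then show ?thesis by (auto simp: smooth_map_def points_prod_atlas)
qed

lemma smooth_map_slice_left:
  assumes "smooth_atlas A" "b \<in> points B"
  shows "smooth_map A (prod_atlas A B) (\<lambda>x. (x, b))"
proof -
  have "open (snd e ` {x\<in>fst e. (x, b) \<in> fst p}) \<and>
      smooth_on (snd e ` {x\<in>fst e. (x, b) \<in> fst p}) (snd p \<circ> (\<lambda>x. (x, b)) \<circ> chart_inv e)"
    if p: "p \<in> prod_atlas A B" and e: "e \<in> A" for p e
  proof -
    obtain c d where c: "c \<in> A" "d \<in> B" "p = (fst c \<times> fst d, map_prod (snd c) (snd d))"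
      using p by (rule prod_atlasE)
    let ?S = "snd e ` {x\<in>fst e. (x, b) \<in> fst p}"
    have sub: "?S \<subseteq> snd e ` (fst e \<inter> fst c)" using c by auto
    \<comment> \<open>If \<open>b\<close> lies outside the second factor of the product chart, the
      slice misses its domain altogether.\<close>
    have "{x\<in>fst e. (x, b) \<in> fst p} = (if b \<in> fst d then fst e \<inter> fst c else {})" using c by auto
    then have S: "open ?S" using smooth_atlas_transition(1)[OF assms(1) e c(1)] by auto
    have "smooth_on ?S (\<lambda>y. ((snd c \<circ> chart_inv e) y, snd d b))"
      by (rule smooth_on_Pair[OF S smooth_on_subset[OF smooth_atlas_transition(2)[OF assms(1) e c(1)] sub]
            smooth_on_const])
    moreover have "snd p \<circ> (\<lambda>x. (x, b)) \<circ> chart_inv e = (\<lambda>y. ((snd c \<circ> chart_inv e) y, snd d b))"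
      by (simp add: c(3) fun_eq_iff)
    ultimately show ?thesis using S by simp
  qed
  then show ?thesis using assms(2) by (auto simp: smooth_map_def points_prod_atlas)
qed

lemma smooth_map_slice_right:
  assumes "smooth_atlas B" "a \<in> points A"
  shows "smooth_map B (prod_atlas A B) (\<lambda>y. (a, y))"
proof -
  have "open (snd e ` {y\<in>fst e. (a, y) \<in> fst p}) \<and>
      smooth_on (snd e ` {y\<in>fst e. (a, y) \<in> fst p}) (snd p \<circ> (\<lambda>y. (a, y)) \<circ> chart_inv e)"
    if p: "p \<in> prod_atlas A B" and e: "e \<in> B" for p e
  proof -
    obtain c d where c: "c \<in> A" "d \<in> B" "p = (fst c \<times> fst d, map_prod (snd c) (snd d))"
      using p by (rule prod_atlasE)
    let ?S = "snd e ` {y\<in>fst e. (a, y) \<in> fst p}"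
    have sub: "?S \<subseteq> snd e ` (fst e \<inter> fst d)" using c by auto
    have "{y\<in>fst e. (a, y) \<in> fst p} = (if a \<in> fst c then fst e \<inter> fst d else {})" using c by auto
    then have S: "open ?S" using smooth_atlas_transition(1)[OF assms(1) e c(2)] by auto
    have "smooth_on ?S (\<lambda>y. (snd c a, (snd d \<circ> chart_inv e) y))"
      by (rule smooth_on_Pair[OF S smooth_on_const
            smooth_on_subset[OF smooth_atlas_transition(2)[OF assms(1) e c(2)] sub]])
    moreover have "snd p \<circ> (\<lambda>y. (a, y)) \<circ> chart_inv e = (\<lambda>y. (snd c a, (snd d \<circ> chart_inv e) y))"
      by (simp add: c(3) fun_eq_iff)
    ultimately show ?thesis using S by simp
  qed
  then show ?thesis using assms(2) by (auto simp: smooth_map_def points_prod_atlas)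
qed

section \<open>Stereographic charts of the sphere\<close>

text \<open>
  The sign \<open>s\<close> selects the pole: \<open>s = - 1\<close> gives the (conjugated) projection from the north
  pole and \<open>s = 1\<close> the projection from the south pole.
\<close>

definition stereo :: "real \<Rightarrow> real^3 \<Rightarrow> complex"
  where "stereo s q = Complex (q $ 1 / (1 + s * q $ 3)) (s * q $ 2 / (1 + s * q $ 3))"

definition stereo_chart :: "real \<Rightarrow> (real^3, complex) chart"
  where "stereo_chart s = ({q \<in> sphere 0 1. q $ 3 \<noteq> - s}, stereo s)"

definition stereo_inv :: "real \<Rightarrow> complex \<Rightarrow> real^3"
  where "stereo_inv s z = (1 / (1 + (Re z)\<^sup>2 + (Im z)\<^sup>2)) *\<^sub>R
    vector [2 * Re z, 2 * s * Im z, s * (1 - (Re z)\<^sup>2 - (Im z)\<^sup>2)]"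

text \<open>For s = 1 and s = -1 this is the differential of the formula \<open>stereo s\<close> at
  \<open>q = stereo_inv s z\<close>, on all of \<open>real^3\<close>, expressed in z through 1 / (1
  + s q3) = (1 + |z|^2) / 2.\<close>

definition stereo_deriv :: "real \<Rightarrow> complex \<Rightarrow> real^3 \<Rightarrow> complex"
  where "stereo_deriv s z w = ((1 + (Re z)\<^sup>2 + (Im z)\<^sup>2) / 2) *\<^sub>R
    Complex (w $ 1 - s * w $ 3 * Re z) (s * w $ 2 - s * w $ 3 * Im z)"

text \<open>The quotient rule applied to \<open>stereo_inv\<close>: \<open>N\<close> is the common
  denominator and \<open>2 * r\<close> its derivative in the direction \<open>u\<close>.\<close>

definition stereo_inv_deriv :: "real \<Rightarrow> complex \<Rightarrow> complex \<Rightarrow> real^3"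
  where "stereo_inv_deriv s z u =
    (let N = 1 + (Re z)\<^sup>2 + (Im z)\<^sup>2; r = Re z * Re u + Im z * Im u
     in vector [2 * Re u / N - 4 * Re z * r / N\<^sup>2, s * (2 * Im u / N - 4 * Im z * r / N\<^sup>2),
       - 4 * s * r / N\<^sup>2])"

lemma sphere_atlas_stereo: "sphere_atlas = {stereo_chart (- 1), stereo_chart 1}"
  by (simp add: sphere_atlas_def stereo_chart_def stereo_def[abs_def])

lemma sphere_atlasE:
  assumes "d \<in> sphere_atlas"
  obtains s where "s * s = 1" "d = stereo_chart s"
  using assms by (force simp: sphere_atlas_stereo)

lemma stereo_chart_in_atlas: "s * s = 1 \<Longrightarrow> stereo_chart s \<in> sphere_atlas"
  using square_eq_1_iff[of s] by (auto simp: sphere_atlas_stereo)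

lemma sign_cases: "s * s = 1 \<Longrightarrow> s = 1 \<or> s = (- 1 :: real)"
  using square_eq_1_iff by blast

lemma norm_vec3: "norm (q :: real^3) = 1 \<longleftrightarrow> (q $ 1)\<^sup>2 + (q $ 2)\<^sup>2 + (q $ 3)\<^sup>2 = 1"
  by (simp add: norm_eq_1 inner_vec_def sum_3 power2_eq_square)

lemma one_plus_squares_pos: "1 + (Re z)\<^sup>2 + (Im z)\<^sup>2 > 0"
  by (smt (verit) zero_le_power2)

lemma one_plus_squares_nonzero: "1 + (Re z)\<^sup>2 + (Im z)\<^sup>2 \<noteq> 0"
  using one_plus_squares_pos[of z] by simp

lemma stereo_inv_nth:
  "stereo_inv s z $ 1 = 2 * Re z / (1 + (Re z)\<^sup>2 + (Im z)\<^sup>2)"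
  "stereo_inv s z $ 2 = 2 * s * Im z / (1 + (Re z)\<^sup>2 + (Im z)\<^sup>2)"
  "stereo_inv s z $ 3 = s * (1 - (Re z)\<^sup>2 - (Im z)\<^sup>2) / (1 + (Re z)\<^sup>2 + (Im z)\<^sup>2)"
  by (simp_all add: stereo_inv_def)

lemma stereo_inv_denominator:
  assumes "s * s = 1"
  shows "1 + s * stereo_inv s z $ 3 = 2 / (1 + (Re z)\<^sup>2 + (Im z)\<^sup>2)"
  using sign_cases[OF assms] one_plus_squares_nonzero[of z] by (auto simp: stereo_inv_nth field_simps)

lemma stereo_inv_sphere:
  assumes "s * s = 1"
  shows "norm (stereo_inv s z) = 1"
proof -
  define x y N where "x = Re z" and "y = Im z" and "N = 1 + x\<^sup>2 + y\<^sup>2"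
  have N: "N \<noteq> 0" using one_plus_squares_nonzero[of z] by (simp add: x_def y_def N_def)
  have s2: "s\<^sup>2 = 1" using assms by (simp add: power2_eq_square)
  have "(2 * x / N)\<^sup>2 + (2 * s * y / N)\<^sup>2 + (s * (1 - x\<^sup>2 - y\<^sup>2) / N)\<^sup>2 =
      (4 * x\<^sup>2 + 4 * y\<^sup>2 + (1 - x\<^sup>2 - y\<^sup>2)\<^sup>2) / N\<^sup>2"
    using s2 by (simp add: power_divide power_mult_distrib add_divide_distrib)
  also have "4 * x\<^sup>2 + 4 * y\<^sup>2 + (1 - x\<^sup>2 - y\<^sup>2)\<^sup>2 = N\<^sup>2"
    unfolding N_def by (simp add: power2_eq_square algebra_simps)
  finally show ?thesis
    using N by (simp add: norm_vec3 stereo_inv_nth flip: x_def y_def N_def)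
qed

lemma stereo_stereo_inv:
  assumes "s * s = 1"
  shows "stereo s (stereo_inv s z) = z"
  using sign_cases[OF assms] one_plus_squares_nonzero[of z]
  by (simp add: stereo_def stereo_inv_denominator[OF assms] complex_eq_iff)
    (auto simp: stereo_inv_nth field_simps)

lemma stereo_inv_chart:
  assumes "s * s = 1"
  shows "stereo_inv s z \<in> fst (stereo_chart s)"
proof -
  have "stereo_inv s z $ 3 \<noteq> - s"
  proof
    assume "stereo_inv s z $ 3 = - s"
    then show False
      using stereo_inv_denominator[OF assms, of z] one_plus_squares_nonzero[of z] assms by simp
  qed
  then show ?thesis
    using stereo_inv_sphere[OF assms] by (simp add: stereo_chart_def)
qed

lemma stereo_denominator:
  assumes "s * s = 1" "q \<in> fst (stereo_chart s)"
  shows "1 + s * q $ 3 \<noteq> 0"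
proof
  assume "1 + s * q $ 3 = 0"
  then have "s * (1 + s * q $ 3) = 0" by simp
  then have "s + (s * s) * q $ 3 = 0" by (simp add: algebra_simps)
  then show False using assms by (simp add: stereo_chart_def)
qed

text \<open>Unit length of \<open>q\<close> turns (1 + s q3)^2 + q1^2 + q2^2 into 2 (1 + s q3);
  division by (1 + s q3)^2 gives the formula.\<close>

lemma stereo_N:
  assumes "s * s = 1" "q \<in> fst (stereo_chart s)"
  shows "1 + (Re (stereo s q))\<^sup>2 + (Im (stereo s q))\<^sup>2 = 2 / (1 + s * q $ 3)"
proof -
  define D where "D = 1 + s * q $ 3"
  have D: "D \<noteq> 0" using stereo_denominator[OF assms] by (simp add: D_def)
  have "(q $ 1)\<^sup>2 + (q $ 2)\<^sup>2 + (q $ 3)\<^sup>2 = 1"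
    using assms(2) norm_vec3[of q] by (simp add: stereo_chart_def)
  then have "D\<^sup>2 + (q $ 1)\<^sup>2 + (s * q $ 2)\<^sup>2 = 2 * D"
    using sign_cases[OF assms(1)] by (auto simp: D_def power2_eq_square algebra_simps)
  moreover have "1 + (Re (stereo s q))\<^sup>2 + (Im (stereo s q))\<^sup>2 = (D\<^sup>2 + (q $ 1)\<^sup>2 + (s * q $ 2)\<^sup>2) / D\<^sup>2"
    using D by (simp add: stereo_def power_divide add_divide_distrib flip: D_def)
  ultimately show ?thesis
    using D by (simp add: power2_eq_square flip: D_def)
qed

lemma stereo_inv_stereo:
  assumes "s * s = 1" "q \<in> fst (stereo_chart s)"
  shows "stereo_inv s (stereo s q) = q"
proof -
  let ?z = "stereo s q" and ?D = "1 + s * q $ 3"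
  have D: "?D \<noteq> 0" by (rule stereo_denominator[OF assms])
  have s: "s * (s * a) = a" for a using assms(1) by (metis mult.assoc mult_1)
  have N: "1 + (Re ?z)\<^sup>2 + (Im ?z)\<^sup>2 = 2 / ?D" by (rule stereo_N[OF assms])
  then have "1 - (Re ?z)\<^sup>2 - (Im ?z)\<^sup>2 = 2 - 2 / ?D" by linarith
  then have "stereo_inv s ?z $ 3 = s * (2 - 2 / ?D) / (2 / ?D)"
    by (simp only: stereo_inv_nth N)
  also have "\<dots> = s * (?D - 1)"
    using D by (simp add: field_simps)
  also have "\<dots> = q $ 3" using s by (simp add: algebra_simps)
  finally have 3: "stereo_inv s ?z $ 3 = q $ 3" .
  have "stereo_inv s ?z $ 1 = q $ 1" "stereo_inv s ?z $ 2 = q $ 2"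
    unfolding stereo_inv_nth N using D sign_cases[OF assms(1)] by (auto simp: stereo_def field_simps)
  with 3 show ?thesis by (simp add: vec_eq_iff forall_3)
qed

lemma stereo_chart_bij:
  assumes "s * s = 1"
  shows "inj_on (stereo s) (fst (stereo_chart s))" "stereo s ` fst (stereo_chart s) = UNIV"
    and "chart_inv (stereo_chart s) = stereo_inv s"
proof -
  show inj: "inj_on (stereo s) (fst (stereo_chart s))"
    by (metis stereo_inv_stereo[OF assms] inj_onI)
  show "stereo s ` fst (stereo_chart s) = UNIV"
    using stereo_stereo_inv[OF assms] stereo_inv_chart[OF assms] by (metis UNIV_eq_I imageI)
  show "chart_inv (stereo_chart s) = stereo_inv s"
  proof
    fix z
    have "chart_inv (stereo_chart s) (snd (stereo_chart s) (stereo_inv s z)) = stereo_inv s z"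
      by (rule chart_inv_chart[OF _ stereo_inv_chart[OF assms]]) (use inj in \<open>simp add: stereo_chart_def\<close>)
    then show "chart_inv (stereo_chart s) z = stereo_inv s z"
      by (simp add: stereo_chart_def stereo_stereo_inv[OF assms])
  qed
qed

lemma snd_stereo_chart [simp]: "snd (stereo_chart s) = stereo s"
  by (simp add: stereo_chart_def)

text \<open>The denominator for the opposite pole is 2 |z|^2 / N, and the imaginary part changes
  sign, so the result is cnj z / |z|^2 = 1 / z. Without the conjugation in one chart it would be the
  antiholomorphic 1 / cnj z.\<close>

lemma stereo_transition:
  assumes "s * s = 1" "z \<noteq> 0"
  shows "stereo (- s) (stereo_inv s z) = inverse z"
proof -
  define x y N where "x = Re z" and "y = Im z" and "N = 1 + x\<^sup>2 + y\<^sup>2"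
  have N: "N \<noteq> 0" using one_plus_squares_nonzero[of z] by (simp add: x_def y_def N_def)
  have R: "x\<^sup>2 + y\<^sup>2 \<noteq> 0"
    using assms(2) by (simp add: x_def y_def complex_eq_iff sum_power2_eq_zero_iff)
  have "1 + - s * stereo_inv s z $ 3 = 2 - 2 / N"
    using stereo_inv_denominator[OF assms(1), of z] by (simp add: x_def y_def N_def)
  also have "\<dots> = 2 * (x\<^sup>2 + y\<^sup>2) / N"
    using N by (simp add: field_simps) (simp add: N_def)
  finally have D: "1 + - s * stereo_inv s z $ 3 = 2 * (x\<^sup>2 + y\<^sup>2) / N" .
  have q: "stereo_inv s z $ 1 = 2 * x / N" "stereo_inv s z $ 2 = 2 * s * y / N"
    by (simp_all add: stereo_inv_nth x_def y_def N_def)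
  have "2 * x / N / (2 * R / N) = x / R" "- s * (2 * s * y / N) / (2 * R / N) = - y / R" if "R \<noteq> 0" for R
    using N that sign_cases[OF assms(1)] by auto
  from this[OF R] show ?thesis
    unfolding stereo_def D q by (simp add: complex_eq_iff x_def y_def)
qed

text \<open>The only point of this chart missing from the other one is the pole with third component
  \<open>s\<close>, and its coordinate is zero.\<close>

lemma stereo_chart_overlap:
  assumes "s * s = 1"
  shows "stereo s ` (fst (stereo_chart s) \<inter> fst (stereo_chart (- s))) = - {0}"
proof (intro equalityI subsetI)
  fix z assume "z \<in> stereo s ` (fst (stereo_chart s) \<inter> fst (stereo_chart (- s)))"
  then obtain q where q: "z = stereo s q" "q \<in> fst (stereo_chart s)" "q $ 3 \<noteq> s"
    by (auto simp: stereo_chart_def)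
  then have "q $ 3 = stereo_inv s z $ 3" using stereo_inv_stereo[OF assms q(2)] by simp
  then have "z \<noteq> 0" using q(3) by (auto simp: stereo_inv_nth)
  then show "z \<in> - {0}" by simp
next
  fix z :: complex assume "z \<in> - {0}"
  then have R: "(Re z)\<^sup>2 + (Im z)\<^sup>2 \<noteq> 0" by (simp add: complex_eq_iff sum_power2_eq_zero_iff)
  have "stereo_inv s z $ 3 \<noteq> s"
  proof
    assume "stereo_inv s z $ 3 = s"
    then have "2 / (1 + (Re z)\<^sup>2 + (Im z)\<^sup>2) = 2"
      using stereo_inv_denominator[OF assms, of z] assms by simp
    then show False using R one_plus_squares_nonzero[of z] by (simp add: field_simps)
  qed
  then have "stereo_inv s z \<in> fst (stereo_chart s) \<inter> fst (stereo_chart (- s))"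
    using stereo_inv_chart[OF assms, of z] by (simp add: stereo_chart_def)
  then show "z \<in> stereo s ` (fst (stereo_chart s) \<inter> fst (stereo_chart (- s)))"
    using stereo_stereo_inv[OF assms] by (metis imageI)
qed

lemma sphere_atlas_overlap:
  assumes "c \<in> sphere_atlas" "d \<in> sphere_atlas"
  shows "open (snd c ` (fst c \<inter> fst d)) \<and> smooth_on (snd c ` (fst c \<inter> fst d)) (snd d \<circ> chart_inv c)"
proof -
  obtain s where s: "s * s = 1" "c = stereo_chart s" using assms(1) by (rule sphere_atlasE)
  obtain r where r: "r * r = 1" "d = stereo_chart r" using assms(2) by (rule sphere_atlasE)
  have "r = s \<or> r = - s"
    using s(1) r(1) by (metis square_eq_iff)
  then show ?thesis
  proof
    assume rs: "r = s"
    then have im: "snd c ` (fst c \<inter> fst d) = UNIV" and f: "snd d \<circ> chart_inv c = (\<lambda>z. z)"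
      using s r stereo_chart_bij[OF s(1)] stereo_stereo_inv[OF s(1)] by (auto simp: fun_eq_iff)
    show ?thesis
      unfolding im f using smooth_on_linear[OF bounded_linear_ident] open_UNIV by blast
  next
    assume rs: "r = - s"
    have im: "snd c ` (fst c \<inter> fst d) = - {0}"
      using stereo_chart_overlap[OF s(1)] s(2) r(2) rs by simp
    have f: "inverse z = (snd d \<circ> chart_inv c) z" if "z \<in> - {0}" for z
      using stereo_transition[OF s(1), of z] that s r rs stereo_chart_bij(3)[OF s(1)] by simp
    have "smooth_on (- {0}) (snd d \<circ> chart_inv c)"
      by (rule smooth_on_cong[OF _ _ f]) (auto simp: smooth_on_def Ck_on_inverse)
    then show ?thesis unfolding im by auto
  qed
qed

lemma smooth_atlas_sphere: "smooth_atlas sphere_atlas"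
proof -
  have "inj_on (snd c) (fst c) \<and> open (snd c ` fst c)" if c: "c \<in> sphere_atlas" for c
  proof -
    obtain s where "s * s = 1" "c = stereo_chart s" using c by (rule sphere_atlasE)
    then show ?thesis using stereo_chart_bij by simp
  qed
  then show ?thesis using sphere_atlas_overlap by (auto simp: smooth_atlas_def)
qed

lemma points_sphere_atlas: "points sphere_atlas = sphere 0 1"
  by (auto simp: points_def sphere_atlas_stereo stereo_chart_def)

section \<open>Tangent vectors of the sphere\<close>

lemma stereo_inv_has_derivative:
  "(stereo_inv s has_derivative stereo_inv_deriv s z) (at z)"
proof -
  define N where "N = (\<lambda>z. 1 + (Re z)\<^sup>2 + (Im z)\<^sup>2)"
  have N: "N w \<noteq> 0" and Neq: "1 + (Re w)\<^sup>2 + (Im w)\<^sup>2 = N w" for w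
    using one_plus_squares_nonzero by (simp_all add: N_def)
  have dN: "(N has_derivative (\<lambda>u. 2 * (Re z * Re u + Im z * Im u))) (at z)"
    unfolding N_def by (auto intro!: derivative_eq_intros simp: algebra_simps)
  have d: "((\<lambda>w. f w / N w) has_derivative
      (\<lambda>u. f' u / N z - f z * (2 * (Re z * Re u + Im z * Im u)) / (N z)\<^sup>2)) (at z)"
    if "(f has_derivative f') (at z)" for f f'
    by (rule has_derivative_eq_rhs[OF has_derivative_divide'[OF that dN N]])
      (use N[of z] in \<open>simp add: fun_eq_iff field_simps power2_eq_square\<close>)
  have c1: "((\<lambda>w. stereo_inv s w $ 1) has_derivative (\<lambda>u. stereo_inv_deriv s z u $ 1)) (at z)"
    unfolding stereo_inv_nth Neq
    by (rule has_derivative_eq_rhs[OF d[of _ "\<lambda>u. 2 * Re u"]])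
      (auto intro!: derivative_eq_intros simp: stereo_inv_deriv_def N_def Let_def)
  have c2: "((\<lambda>w. stereo_inv s w $ 2) has_derivative (\<lambda>u. stereo_inv_deriv s z u $ 2)) (at z)"
    unfolding stereo_inv_nth Neq
    by (rule has_derivative_eq_rhs[OF d[of _ "\<lambda>u. 2 * s * Im u"]])
      (auto intro!: derivative_eq_intros simp: stereo_inv_deriv_def N_def Let_def algebra_simps)
  \<comment> \<open>The third numerator is affine in \<open>N\<close>, so its derivative comes from
    \<open>dN\<close>.\<close>
  have eq: "1 - (Re w)\<^sup>2 - (Im w)\<^sup>2 = 2 - N w" for w by (simp add: N_def)
  have d3: "stereo_inv_deriv s z u $ 3 = - 4 * s * (Re z * Re u + Im z * Im u) / (N z)\<^sup>2" for u
    by (simp add: stereo_inv_deriv_def Let_def Neq)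
  have "((\<lambda>w. s * (2 - N w) / N w) has_derivative (\<lambda>u. stereo_inv_deriv s z u $ 3)) (at z)"
    by (rule has_derivative_eq_rhs[OF d[of _ "\<lambda>u. - (s * (2 * (Re z * Re u + Im z * Im u)))"]])
      (use N[of z] in \<open>auto intro!: derivative_eq_intros dN simp: d3 fun_eq_iff field_simps power2_eq_square\<close>)
  then have c3: "((\<lambda>w. stereo_inv s w $ 3) has_derivative (\<lambda>u. stereo_inv_deriv s z u $ 3)) (at z)"
    unfolding stereo_inv_nth by (simp only: eq N_def)
  show ?thesis
    using c1 c2 c3 unfolding has_derivative_componentwise_within[of "stereo_inv s"]
    by (auto simp: Basis_vec_def inner_axis forall_3)
qed

lemma stereo_deriv_inv_deriv:
  assumes "s * s = 1"
  shows "stereo_deriv s z (stereo_inv_deriv s z u) = u"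
proof -
  define x y N a b where "x = Re z" and "y = Im z" and "N = 1 + x\<^sup>2 + y\<^sup>2" and "a = Re u" and "b = Im u"
  define r where "r = x * a + y * b"
  have N: "N \<noteq> 0" using one_plus_squares_nonzero[of z] by (simp add: x_def y_def N_def)
  have "N / 2 * (2 * a / N - 4 * x * r / N\<^sup>2 - s * (- 4 * s * r / N\<^sup>2) * x) = a"
    using N sign_cases[OF assms] by (auto simp: field_simps power2_eq_square)
  moreover have "N / 2 * (s * (s * (2 * b / N - 4 * y * r / N\<^sup>2)) - s * (- 4 * s * r / N\<^sup>2) * y) = b"
    using N sign_cases[OF assms] by (auto simp: field_simps power2_eq_square)
  ultimately show ?thesis
    by (simp add: stereo_deriv_def stereo_inv_deriv_def Let_def complex_eq_iff
        flip: x_def y_def N_def a_def b_def r_def)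
qed

lemma stereo_inv_orthogonal:
  "stereo_inv s z \<bullet> w = 0 \<longleftrightarrow>
    2 * Re z * w $ 1 + 2 * s * Im z * w $ 2 + s * (1 - (Re z)\<^sup>2 - (Im z)\<^sup>2) * w $ 3 = 0"
proof -
  have "stereo_inv s z \<bullet> w = (2 * Re z * w $ 1 + 2 * s * Im z * w $ 2 +
      s * (1 - (Re z)\<^sup>2 - (Im z)\<^sup>2) * w $ 3) / (1 + (Re z)\<^sup>2 + (Im z)\<^sup>2)"
    by (simp add: inner_vec_def sum_3 stereo_inv_nth add_divide_distrib)
  then show ?thesis using one_plus_squares_nonzero[of z] by simp
qed

text \<open>The values of \<open>stereo_inv_deriv\<close> are tangent to the sphere, so the vector
  has to be orthogonal to the base point. With \<open>stereo_deriv_inv_deriv\<close> this identifies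
  the coordinate space with the tangent plane.\<close>

lemma stereo_inv_deriv_deriv:
  assumes "s * s = 1" "stereo_inv s z \<bullet> w = 0"
  shows "stereo_inv_deriv s z (stereo_deriv s z w) = w"
proof -
  define x y N where "x = Re z" and "y = Im z" and "N = 1 + x\<^sup>2 + y\<^sup>2"
  define a b where "a = N / 2 * (w $ 1 - s * w $ 3 * x)" and "b = N / 2 * (s * w $ 2 - s * w $ 3 * y)"
  define r where "r = x * a + y * b"
  have N: "N \<noteq> 0" using one_plus_squares_nonzero[of z] by (simp add: x_def y_def N_def)
  have s: "s * (s * t) = t" for t using assms by (metis mult.assoc mult_1)
  have ab: "Re (stereo_deriv s z w) = a" "Im (stereo_deriv s z w) = b"
    by (simp_all add: stereo_deriv_def a_def b_def x_def y_def N_def)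
  have "2 * x * w $ 1 + 2 * s * y * w $ 2 + s * (1 - x\<^sup>2 - y\<^sup>2) * w $ 3 = 0"
    using assms(2) by (simp add: stereo_inv_orthogonal x_def y_def)
  \<comment> \<open>The bracket is the left side of the orthogonality relation minus
    \<open>s * w $ 3 * N\<close>; hence \<open>r\<close> depends only on \<open>N\<close> and the
    third component of \<open>w\<close>.\<close>
  moreover have "4 * r = N * (2 * x * w $ 1 + 2 * s * y * w $ 2 + s * (1 - x\<^sup>2 - y\<^sup>2) * w $ 3 - s * w $ 3 * N)"
    unfolding r_def a_def b_def by (simp add: N_def power2_eq_square field_simps)
  ultimately have "4 * r = - s * w $ 3 * N\<^sup>2"
    by (simp add: power2_eq_square)
  then have r: "4 * r / N\<^sup>2 = - s * w $ 3" using N by (simp add: field_simps)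
  have "2 * a / N - 4 * x * r / N\<^sup>2 = 2 * a / N - x * (4 * r / N\<^sup>2)" by simp
  also have "\<dots> = w $ 1" unfolding r using N by (simp add: a_def field_simps)
  finally have 1: "2 * a / N - 4 * x * r / N\<^sup>2 = w $ 1" .
  have "s * (2 * b / N - 4 * y * r / N\<^sup>2) = s * (2 * b / N - y * (4 * r / N\<^sup>2))" by simp
  also have "2 * b / N - y * (4 * r / N\<^sup>2) = s * w $ 2" unfolding r using N by (simp add: b_def field_simps)
  finally have 2: "s * (2 * b / N - 4 * y * r / N\<^sup>2) = w $ 2" using s by simp
  have "- 4 * s * r / N\<^sup>2 = - s * (4 * r / N\<^sup>2)" by simp
  then have 3: "- 4 * s * r / N\<^sup>2 = w $ 3" unfolding r using s by simp
  show ?thesis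
    using 1 2 3 by (simp add: vec_eq_iff forall_3 stereo_inv_deriv_def Let_def ab flip: x_def y_def N_def r_def)
qed

text \<open>Differentiate the constant squared length of \<open>stereo_inv s z\<close>.\<close>

lemma stereo_inv_deriv_orthogonal:
  assumes "s * s = 1"
  shows "stereo_inv s z \<bullet> stereo_inv_deriv s z u = 0"
proof -
  have "((\<lambda>w. stereo_inv s w \<bullet> stereo_inv s w) has_derivative
      (\<lambda>u. stereo_inv s z \<bullet> stereo_inv_deriv s z u + stereo_inv_deriv s z u \<bullet> stereo_inv s z)) (at z)"
    by (rule has_derivative_inner[OF stereo_inv_has_derivative stereo_inv_has_derivative])
  moreover have "(\<lambda>w. stereo_inv s w \<bullet> stereo_inv s w) = (\<lambda>w. 1)"
    using stereo_inv_sphere[OF assms] by (simp add: norm_eq_1)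
  ultimately have "(\<lambda>u. stereo_inv s z \<bullet> stereo_inv_deriv s z u + stereo_inv_deriv s z u \<bullet> stereo_inv s z) = (\<lambda>u. 0)"
    using has_derivative_unique has_derivative_const by metis
  from fun_cong[OF this, of u] show ?thesis by (simp add: inner_commute)
qed

text \<open>On the tangent plane at \<open>q\<close>, the cross product with \<open>q\<close> is a
  quarter turn. The charts are conformal, and for either sign \<open>s\<close> their orientation
  fits this turn, so it becomes multiplication by \<open>\<i>\<close> and not by
  \<open>- \<i>\<close>.\<close>

lemma stereo_deriv_cross:
  assumes "s * s = 1" "stereo_inv s z \<bullet> w = 0"
  shows "stereo_deriv s z (cross3 (stereo_inv s z) w) = \<i> * stereo_deriv s z w"
proof -
  define x y N where "x = Re z" and "y = Im z" and "N = 1 + x\<^sup>2 + y\<^sup>2"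
  have N: "N \<noteq> 0" using one_plus_squares_nonzero[of z] by (simp add: x_def y_def N_def)
  define c where "c = cross3 (stereo_inv s z) w"
  have c: "N * c $ 1 = 2 * s * y * w $ 3 - s * (1 - x\<^sup>2 - y\<^sup>2) * w $ 2"
    "N * c $ 2 = s * (1 - x\<^sup>2 - y\<^sup>2) * w $ 1 - 2 * x * w $ 3"
    "N * c $ 3 = 2 * x * w $ 2 - 2 * s * y * w $ 1"
    using N by (simp_all add: c_def cross3_def stereo_inv_nth right_diff_distrib flip: x_def y_def N_def)
  have w: "2 * x * w $ 1 + 2 * s * y * w $ 2 + s * (1 - x\<^sup>2 - y\<^sup>2) * w $ 3 = 0"
    using assms(2) by (simp add: stereo_inv_orthogonal x_def y_def)
  \<comment> \<open>Once the denominator \<open>N\<close> is cleared, the defect in each of the two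
    real equations is a multiple of the orthogonality relation for \<open>w\<close>: by
    \<open>y\<close> for the real part and by \<open>- x\<close> for the imaginary part.\<close>
  have "N * (c $ 1 - s * c $ 3 * x) + N * (s * w $ 2 - s * w $ 3 * y) =
      N * c $ 1 - s * x * (N * c $ 3) + N * (s * w $ 2 - s * w $ 3 * y)"
    by (simp add: algebra_simps)
  also have "\<dots> = y * (2 * x * w $ 1 + 2 * s * y * w $ 2 + s * (1 - x\<^sup>2 - y\<^sup>2) * w $ 3)"
    unfolding c using sign_cases[OF assms(1)] by (auto simp: N_def power2_eq_square algebra_simps)
  finally have "N * (c $ 1 - s * c $ 3 * x) = - (N * (s * w $ 2 - s * w $ 3 * y))"
    unfolding w by simp
  then have 1: "c $ 1 - s * c $ 3 * x = - (s * w $ 2 - s * w $ 3 * y)"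
    using N by (metis minus_mult_right mult_left_cancel)
  have "N * (s * c $ 2 - s * c $ 3 * y) - N * (w $ 1 - s * w $ 3 * x) =
      s * (N * c $ 2) - s * y * (N * c $ 3) - N * (w $ 1 - s * w $ 3 * x)"
    by (simp add: algebra_simps)
  also have "\<dots> = - x * (2 * x * w $ 1 + 2 * s * y * w $ 2 + s * (1 - x\<^sup>2 - y\<^sup>2) * w $ 3)"
    unfolding c using sign_cases[OF assms(1)] by (auto simp: N_def power2_eq_square algebra_simps)
  finally have "N * (s * c $ 2 - s * c $ 3 * y) = N * (w $ 1 - s * w $ 3 * x)"
    unfolding w by simp
  then have 2: "s * c $ 2 - s * c $ 3 * y = w $ 1 - s * w $ 3 * x"
    using N by simp
  show ?thesis
    unfolding stereo_deriv_def x_def[symmetric] y_def[symmetric] c_def[symmetric] 1 2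
    by (simp add: complex_eq_iff)
qed

text \<open>
  The coordinate expression of the section of the holomorphic tangent bundle given by a constant
  vector: its coefficients are constant and it is holomorphic, of degree two, in \<open>z\<close>.
\<close>

definition nO2_poly :: "real \<Rightarrow> complex \<Rightarrow> real^3 \<Rightarrow> complex"
  where "nO2_poly s z a = (Complex (a $ 1) (s * a $ 2) - of_real (2 * s * a $ 3) * z
    - Complex (a $ 1) (- s * a $ 2) * z\<^sup>2) / 2"

text \<open>\<open>stereo_deriv\<close> sends \<open>q\<close> itself to (N / 2) z, so the
  projection subtracts (N / 2) (a . q) z. As N (a . q) is polynomial in x and y, no denominator
  survives, and the terms involving cnj z cancel.\<close>

lemma stereo_deriv_projection:
  assumes "s * s = 1"
  shows "stereo_deriv s z (a - (a \<bullet> stereo_inv s z) *\<^sub>R stereo_inv s z) = nO2_poly s z a"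
proof -
  define x y N where "x = Re z" and "y = Im z" and "N = 1 + x\<^sup>2 + y\<^sup>2"
  have N: "N \<noteq> 0" using one_plus_squares_nonzero[of z] by (simp add: x_def y_def N_def)
  define q t w where "q = stereo_inv s z" and "t = a \<bullet> q" and "w = a - t *\<^sub>R q"
  have q: "N * q $ 1 = 2 * x" "N * q $ 2 = 2 * s * y" "N * q $ 3 = s * (1 - x\<^sup>2 - y\<^sup>2)"
    using N by (simp_all add: q_def stereo_inv_nth flip: x_def y_def N_def)
  have "N * t = a $ 1 * (N * q $ 1) + a $ 2 * (N * q $ 2) + a $ 3 * (N * q $ 3)"
    by (simp add: t_def inner_vec_def sum_3 algebra_simps)
  then have t: "N * t = 2 * x * a $ 1 + 2 * s * y * a $ 2 + s * (1 - x\<^sup>2 - y\<^sup>2) * a $ 3"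
    unfolding q by (simp add: algebra_simps)
  have "N * (q $ 1 - s * x * q $ 3) = N * x"
    unfolding right_diff_distrib mult.left_commute[of N] q using sign_cases[OF assms]
    by (auto simp: N_def power2_eq_square algebra_simps)
  then have q1: "q $ 1 - s * x * q $ 3 = x" using N by simp
  have "N * (s * q $ 2 - s * y * q $ 3) = N * y"
    unfolding right_diff_distrib mult.left_commute[of N] q using sign_cases[OF assms]
    by (auto simp: N_def power2_eq_square algebra_simps)
  then have q2: "s * q $ 2 - s * y * q $ 3 = y" using N by simp
  have "w $ 1 - s * w $ 3 * x = a $ 1 - s * x * a $ 3 - t * (q $ 1 - s * x * q $ 3)"
    by (simp add: w_def algebra_simps)
  then have w1: "w $ 1 - s * w $ 3 * x = a $ 1 - s * x * a $ 3 - t * x"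
    unfolding q1 .
  have "N * (w $ 1 - s * w $ 3 * x) = N * (a $ 1 - s * x * a $ 3) - x * (N * t)"
    unfolding w1 by (simp add: algebra_simps)
  then have 1: "N * (w $ 1 - s * w $ 3 * x) = a $ 1 - 2 * s * a $ 3 * x
      - (a $ 1 * (x * x - y * y) + s * a $ 2 * (2 * x * y))"
    unfolding t by (simp add: N_def power2_eq_square algebra_simps)
  have "s * w $ 2 - s * w $ 3 * y = s * a $ 2 - s * y * a $ 3 - t * (s * q $ 2 - s * y * q $ 3)"
    by (simp add: w_def algebra_simps)
  then have w2: "s * w $ 2 - s * w $ 3 * y = s * a $ 2 - s * y * a $ 3 - t * y"
    unfolding q2 .
  have "N * (s * w $ 2 - s * w $ 3 * y) = N * (s * a $ 2 - s * y * a $ 3) - y * (N * t)"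
    unfolding w2 by (simp add: algebra_simps)
  then have 2: "N * (s * w $ 2 - s * w $ 3 * y) = s * a $ 2 - 2 * s * a $ 3 * y
      - (a $ 1 * (2 * x * y) - s * a $ 2 * (x * x - y * y))"
    unfolding t by (simp add: N_def power2_eq_square algebra_simps)
  have "stereo_deriv s z w = Complex (N * (w $ 1 - s * w $ 3 * x) / 2) (N * (s * w $ 2 - s * w $ 3 * y) / 2)"
    by (simp add: stereo_deriv_def complex_eq_iff x_def y_def N_def)
  also have "\<dots> = nO2_poly s z a"
    unfolding 1 2 nO2_poly_def
    by (simp add: complex_eq_iff power2_eq_square algebra_simps flip: x_def y_def)
  finally show ?thesis by (simp add: w_def t_def q_def)
qed

lemma sphere_chartE:
  assumes "q \<in> sphere 0 1"
  obtains s where "s * s = 1" "q \<in> fst (stereo_chart s)"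
proof (cases "q $ 3 = 1")
  case True
  then show ?thesis using assms that[of 1] by (auto simp: stereo_chart_def)
next
  case False
  then show ?thesis using assms that[of "- 1"] by (auto simp: stereo_chart_def)
qed

lemma stereo_chart_sphere: "q \<in> fst (stereo_chart s) \<Longrightarrow> q \<in> sphere 0 1"
  by (simp add: stereo_chart_def)

context
  fixes s :: real and q :: "real^3"
  assumes s: "s * s = 1" and q: "q \<in> fst (stereo_chart s)"
begin

lemma sphere_incl_stereo:
  assumes "\<xi> \<in> tangent_space sphere_atlas q"
  shows "sphere_incl q \<xi> = stereo_inv_deriv s (stereo s q) (\<xi> (stereo_chart s))"
proof -
  have "(((\<lambda>p. p) \<circ> chart_inv (stereo_chart s)) has_derivative stereo_inv_deriv s (stereo s q))
      (at (snd (stereo_chart s) q))"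
    using stereo_inv_has_derivative[of s "stereo s q"] by (simp add: stereo_chart_bij(3)[OF s] o_def)
  from differential_fun_eq[OF smooth_atlas_sphere stereo_chart_in_atlas[OF s] q assms this]
  show ?thesis by (simp add: sphere_incl_def)
qed

lemma stereo_deriv_sphere_incl:
  assumes "\<xi> \<in> tangent_space sphere_atlas q"
  shows "stereo_deriv s (stereo s q) (sphere_incl q \<xi>) = \<xi> (stereo_chart s)"
  by (simp add: sphere_incl_stereo[OF assms] stereo_deriv_inv_deriv[OF s])

lemma sphere_incl_orthogonal_aux:
  assumes "\<xi> \<in> tangent_space sphere_atlas q"
  shows "q \<bullet> sphere_incl q \<xi> = 0"
  using stereo_inv_deriv_orthogonal[OF s, of "stereo s q"]
  by (simp add: sphere_incl_stereo[OF assms] stereo_inv_stereo[OF s q])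

text \<open>With \<open>sphere_incl_orthogonal_aux\<close> this makes the image of
  \<open>sphere_incl q\<close> the whole orthogonal complement of \<open>q\<close>, where the
  \<open>inv_into\<close> in \<open>sphere_vector\<close> is a right inverse.\<close>

lemma sphere_incl_surj:
  assumes "q \<bullet> w = 0"
  shows "w \<in> sphere_incl q ` tangent_space sphere_atlas q"
proof -
  let ?\<xi> = "coord_vector sphere_atlas (stereo_chart s) q (stereo_deriv s (stereo s q) w)"
  note c = smooth_atlas_sphere stereo_chart_in_atlas[OF s] q
  have "?\<xi> \<in> tangent_space sphere_atlas q" by (rule coord_vector_tangent[OF c])
  moreover from this have "sphere_incl q ?\<xi> = w"
    using assms by (simp add: sphere_incl_stereo coord_vector_apply[OF c] stereo_inv_deriv_deriv[OF s]
        stereo_inv_stereo[OF s q])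
  ultimately show ?thesis by (metis imageI)
qed

end

lemma sphere_incl_orthogonal:
  "q \<in> sphere 0 1 \<Longrightarrow> \<xi> \<in> tangent_space sphere_atlas q \<Longrightarrow> q \<bullet> sphere_incl q \<xi> = 0"
  by (erule sphere_chartE) (rule sphere_incl_orthogonal_aux)

lemma
  assumes "q \<in> sphere 0 1" "q \<bullet> w = 0"
  shows sphere_vector_tangent: "sphere_vector q w \<in> tangent_space sphere_atlas q"
    and sphere_incl_vector: "sphere_incl q (sphere_vector q w) = w"
  using sphere_chartE[OF assms(1)] sphere_incl_surj[OF _ _ assms(2)]
  unfolding sphere_vector_def by (metis inv_into_into, metis f_inv_into_f)

text \<open>The preimage chosen by \<open>inv_into\<close> is determined, because
  \<open>stereo_deriv\<close> recovers the coordinate of a tangent vector from its image in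
  \<open>real^3\<close>.\<close>

lemma sphere_vector_stereo:
  assumes "s * s = 1" "q \<in> fst (stereo_chart s)" "q \<bullet> w = 0"
  shows "sphere_vector q w (stereo_chart s) = stereo_deriv s (stereo s q) w"
  using stereo_deriv_sphere_incl[OF assms(1,2) sphere_vector_tangent]
    sphere_incl_vector[OF stereo_chart_sphere] assms stereo_chart_sphere by metis

lemma stereo_deriv_add: "stereo_deriv s z (a + b) = stereo_deriv s z a + stereo_deriv s z b"
  by (simp add: stereo_deriv_def complex_eq_iff algebra_simps add_divide_distrib)

lemma stereo_deriv_scaleR: "stereo_deriv s z (r *\<^sub>R a) = r *\<^sub>R stereo_deriv s z a"
  by (simp add: stereo_deriv_def complex_eq_iff field_simps)

lemma sphere_vector_add:
  assumes "q \<in> sphere 0 1" "q \<bullet> a = 0" "q \<bullet> b = 0"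
  shows "sphere_vector q (a + b) = sphere_vector q a + sphere_vector q b"
proof -
  obtain s where s: "s * s = 1" "q \<in> fst (stereo_chart s)" using assms(1) by (rule sphere_chartE)
  have ab: "q \<bullet> (a + b) = 0" using assms by (simp add: inner_add_right)
  show ?thesis
    by (rule tangent_space_eqI[OF _ _ stereo_chart_in_atlas[OF s(1)] s(2)])
      (use assms ab s in \<open>auto intro!: sphere_vector_tangent
        subspace_add[OF subspace_tangent_space[OF smooth_atlas_sphere]]
        simp: sphere_vector_stereo stereo_deriv_add\<close>)
qed

lemma sphere_vector_scaleR:
  assumes "q \<in> sphere 0 1" "q \<bullet> a = 0"
  shows "sphere_vector q (r *\<^sub>R a) = r *\<^sub>R sphere_vector q a"
proof -
  obtain s where s: "s * s = 1" "q \<in> fst (stereo_chart s)" using assms(1) by (rule sphere_chartE)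
  show ?thesis
    by (rule tangent_space_eqI[OF _ _ stereo_chart_in_atlas[OF s(1)] s(2)])
      (use assms s in \<open>auto intro!: sphere_vector_tangent
        subspace_scale[OF subspace_tangent_space[OF smooth_atlas_sphere]]
        simp: sphere_vector_stereo stereo_deriv_scaleR scaleR_fun_apply\<close>)
qed

lemma sphere_J_tangent:
  "q \<in> sphere 0 1 \<Longrightarrow> sphere_J q \<xi> \<in> tangent_space sphere_atlas q"
  unfolding sphere_J_def by (rule sphere_vector_tangent) (simp_all add: dot_cross_self)

text \<open>This is \<open>stereo_deriv_cross\<close> read on tangent vectors: both stereographic
  charts are holomorphic coordinates for the quaternionic complex structure.\<close>

lemma sphere_J_apply:
  assumes "\<xi> \<in> tangent_space sphere_atlas q" "d \<in> sphere_atlas" "q \<in> fst d"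
  shows "sphere_J q \<xi> d = \<i> * \<xi> d"
proof -
  obtain s where s: "s * s = 1" "d = stereo_chart s" using assms(2) by (rule sphere_atlasE)
  have q: "q \<in> fst (stereo_chart s)" using assms(3) s by simp
  show ?thesis
    using stereo_deriv_cross[OF s(1), of "stereo s q"] sphere_incl_orthogonal[OF stereo_chart_sphere[OF q] assms(1)]
    by (simp add: sphere_J_def s(2) sphere_vector_stereo[OF s(1) q] dot_cross_self
        stereo_inv_stereo[OF s(1) q] stereo_deriv_sphere_incl[OF s(1) q assms(1)])
qed

section \<open>Sections of $n{\cal O}(2)$ and maps into its total space\<close>

lemma nO2_poly_add: "nO2_poly s z (a + b) = nO2_poly s z a + nO2_poly s z b"
  by (simp add: nO2_poly_def complex_eq_iff field_simps)

lemma nO2_poly_scaleR: "nO2_poly s z (r *\<^sub>R a) = r *\<^sub>R nO2_poly s z a"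
  by (simp add: nO2_poly_def complex_eq_iff field_simps)

text \<open>A point of the sphere has zero projection to its own tangent plane, and the cross
  product with it sees only the orthogonal part of \<open>m\<close>, where it acts as
  \<open>\<i>\<close>. This converts the quaternionic form of the derivative of the moment map into
  complex linearity.\<close>

lemma nO2_poly_J:
  assumes "s * s = 1"
  shows "nO2_poly s z (r *\<^sub>R stereo_inv s z + cross3 (stereo_inv s z) m) = \<i> * nO2_poly s z m"
proof -
  let ?q = "stereo_inv s z"
  have qq: "?q \<bullet> ?q = 1" using stereo_inv_sphere[OF assms, of z] by (simp add: norm_eq_1)
  have self: "nO2_poly s z ?q = 0"
    using stereo_deriv_projection[OF assms, of z ?q] stereo_deriv_scaleR[of s z 0] qq by simp
  define w where "w = m - (m \<bullet> ?q) *\<^sub>R ?q"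
  have w: "?q \<bullet> w = 0" using qq by (simp add: w_def inner_diff_right inner_commute)
  have "cross3 ?q m = cross3 ?q w" by (simp add: w_def right_diff_distrib cross_mult_right cross_minus_right cross3_simps)
  moreover have "nO2_poly s z (cross3 ?q w) = stereo_deriv s z (cross3 ?q w)"
    using stereo_deriv_projection[OF assms, of z "cross3 ?q w"] by (simp add: inner_commute[of _ ?q] dot_cross_self)
  moreover have "stereo_deriv s z w = nO2_poly s z m"
    using stereo_deriv_projection[OF assms] by (simp add: w_def)
  ultimately show ?thesis
    using stereo_deriv_cross[OF assms w] by (simp add: nO2_poly_add nO2_poly_scaleR self)
qed

lemma orthogonal_projection:
  assumes "q \<in> sphere 0 (1::real)"
  shows "q \<bullet> (a - (a \<bullet> q) *\<^sub>R q) = 0"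
  using assms by (simp add: inner_diff_right inner_commute norm_eq_1)

lemma nO2_section_stereo:
  assumes "s * s = 1" "q \<in> fst (stereo_chart s)" "v \<in> t"
  shows "snd (nO2_section t f q) v (stereo_chart s) = nO2_poly s (stereo s q) (im_dual (f v))"
  using assms stereo_deriv_projection[OF assms(1), of "stereo s q"]
    orthogonal_projection[OF stereo_chart_sphere[OF assms(2)]]
  by (simp add: nO2_section_def Let_def sphere_vector_stereo stereo_inv_stereo)

lemma nO2_section_points:
  assumes "subspace t" "q \<in> sphere 0 1" "\<And>p. linear_on t (\<lambda>v. f v p)"
  shows "nO2_section t f q \<in> nO2_points t"
proof -
  let ?P = "\<lambda>a. a - (a \<bullet> q) *\<^sub>R q"
  have P: "q \<bullet> ?P a = 0" for a by (rule orthogonal_projection[OF assms(2)])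
  have add: "?P (im_dual (f (v + w))) = ?P (im_dual (f v)) + ?P (im_dual (f w))" if "v \<in> t" "w \<in> t" for v w
  proof -
    have "im_dual (f (v + w)) = im_dual (f v) + im_dual (f w)"
      using assms(3) that by (simp add: im_dual_def linear_on_def vec_eq_iff)
    then show ?thesis by (simp add: inner_add_left algebra_simps)
  qed
  have scale: "?P (im_dual (f (r *\<^sub>R v))) = r *\<^sub>R ?P (im_dual (f v))" if "v \<in> t" for r v
  proof -
    have "im_dual (f (r *\<^sub>R v)) = r *\<^sub>R im_dual (f v)"
      using assms(3) that by (simp add: im_dual_def linear_on_def vec_eq_iff)
    then show ?thesis by (simp add: algebra_simps)
  qed
  have "linear_on t (snd (nO2_section t f q))"
    unfolding linear_on_def
    using subspace_add[OF assms(1)] subspace_scale[OF assms(1)] P assms(2)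
    by (simp add: nO2_section_def Let_def add scale sphere_vector_add sphere_vector_scaleR)
  moreover have "snd (nO2_section t f q) ` t \<subseteq> tangent_space sphere_atlas q"
    using P assms(2) by (auto simp: nO2_section_def Let_def intro!: sphere_vector_tangent)
  ultimately show ?thesis
    using assms(2) by (auto simp: nO2_points_def nO2_section_def)
qed

text \<open>Uses only real scaling, products and linear functions of \<open>a\<close>, the
  operations for which smoothness and derivative rules are available.\<close>

lemma nO2_poly_alt:
  "nO2_poly s z a = (1/2) *\<^sub>R (Complex (a $ 1) (s * a $ 2) - Complex (2 * s * a $ 3) 0 * z
    - Complex (a $ 1) (- (s * a $ 2)) * (z * z))"
  by (simp add: nO2_poly_def complex_eq_iff power2_eq_square)

lemma bounded_linear_Complex_coords:
  "bounded_linear (\<lambda>a :: real^3. Complex (k * a $ i) (l * a $ j))"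
  by (intro linear_conv_bounded_linear[THEN iffD1] linearI) (auto simp: complex_eq_iff algebra_simps)

text \<open>Up to signs and the factor 1/2, the coefficients of 1, z and z^2 as real linear
  functions of the vector. The factor 0 in the second one makes it real.\<close>

lemmas bounded_linear_nO2_coeffs =
  bounded_linear_Complex_coords[of 1 1 s 2 for s, simplified]
  bounded_linear_Complex_coords[of "2 * s" 3 0 3 for s, simplified]
  bounded_linear_Complex_coords[of 1 1 "- s" 2 for s, simplified]

lemma smooth_on_nO2_poly:
  assumes "open S" "smooth_on S z" "smooth_on S a"
  shows "smooth_on S (\<lambda>y. nO2_poly s (z y) (a y))"
  unfolding nO2_poly_alt
  by (intro smooth_on_linear_image[OF bounded_linear_scaleR_right] smooth_on_diff smooth_on_mult assms
      smooth_on_linear_image[OF bounded_linear_nO2_coeffs(1) assms(1,3)]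
      smooth_on_linear_image[OF bounded_linear_nO2_coeffs(2) assms(1,3)]
      smooth_on_linear_image[OF bounded_linear_nO2_coeffs(3) assms(1,3)])

text \<open>The complex derivative of \<open>nO2_poly\<close> in \<open>z\<close>, with the vector
  held fixed.\<close>

definition nO2_poly_deriv :: "real \<Rightarrow> complex \<Rightarrow> real^3 \<Rightarrow> complex"
  where "nO2_poly_deriv s z a = - Complex (s * a $ 3) 0 - Complex (a $ 1) (- (s * a $ 2)) * z"

text \<open>Linearity in the vector gives the first summand. The second is multiplication by a
  complex number, since no conjugate of the complex variable occurs in the polynomial.\<close>

lemma has_derivative_nO2_poly:
  assumes "(z has_derivative z') (at y)" "(a has_derivative a') (at y)"
  shows "((\<lambda>y. nO2_poly s (z y) (a y)) has_derivative
    (\<lambda>u. nO2_poly s (z y) (a' u) + nO2_poly_deriv s (z y) (a y) * z' u)) (at y)"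
proof -
  note coeffs = bounded_linear_nO2_coeffs[THEN bounded_linear.has_derivative, OF assms(2)]
  have "((\<lambda>y. nO2_poly s (z y) (a y)) has_derivative (\<lambda>u. (1/2) *\<^sub>R
      (Complex (a' u $ 1) (s * a' u $ 2) -
       (Complex (2 * s * a y $ 3) 0 * z' u + Complex (2 * s * a' u $ 3) 0 * z y) -
       (Complex (a y $ 1) (- (s * a y $ 2)) * (z y * z' u + z' u * z y) +
        Complex (a' u $ 1) (- (s * a' u $ 2)) * (z y * z y))))) (at y)"
    unfolding nO2_poly_alt
    by (rule has_derivative_scaleR_right[OF has_derivative_diff[OF has_derivative_diff[OF
      coeffs(1) has_derivative_mult[OF coeffs(2) assms(1)]]
      has_derivative_mult[OF coeffs(3) has_derivative_mult[OF assms(1) assms(1)]]]])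
  then show ?thesis
    by (rule has_derivative_eq_rhs)
      (simp add: fun_eq_iff nO2_poly_alt nO2_poly_deriv_def complex_eq_iff field_simps)
qed

lemma nO2_atlasE:
  assumes "e \<in> nO2_atlas t"
  obtains s b where "s * s = 1" "range b \<subseteq> t"
    "e = ({(q, L) \<in> nO2_points t. q \<in> fst (stereo_chart s)},
      \<lambda>(q, L). (stereo s q, \<chi> k. L (b k) (stereo_chart s)))"
proof -
  obtain d b where d: "d \<in> sphere_atlas" "span (range b) = t"
    "e = ({(q, L) \<in> nO2_points t. q \<in> fst d}, \<lambda>(q, L). (snd d q, \<chi> k. L (b k) d))"
    using assms by (auto simp: nO2_atlas_def)
  obtain s where s: "s * s = 1" "d = stereo_chart s" using d(1) by (rule sphere_atlasE)
  show ?thesis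
    by (rule that[OF s(1), of b]) (use d s span_superset[of "range b"] in auto)
qed

text \<open>Every bundle chart comes with a basis of \<open>t\<close> indexed by \<open>'n\<close>,
  so the charts cover the total space once one such basis is known to exist.\<close>

lemma points_nO2_atlas:
  fixes b :: "'n::finite \<Rightarrow> ('t, real^'n) tangent"
  assumes "inj b" "independent (range b)" "span (range b) = t"
  shows "points (nO2_atlas t) = nO2_points t"
proof (intro equalityI subsetI)
  fix p assume "p \<in> points (nO2_atlas t)"
  then show "p \<in> nO2_points t" by (auto simp: points_def nO2_atlas_def)
next
  fix p assume p: "p \<in> nO2_points t"
  obtain q L where qL: "p = (q, L)" by (cases p)
  then have "q \<in> sphere 0 1" using p by (auto simp: nO2_points_def)
  then obtain s where s: "s * s = 1" "q \<in> fst (stereo_chart s)" by (rule sphere_chartE)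
  let ?e = "({(q, L) \<in> nO2_points t. q \<in> fst (stereo_chart s)},
      \<lambda>(q, L). (snd (stereo_chart s) q, \<chi> k. L (b k) (stereo_chart s)))"
  have "?e \<in> nO2_atlas t"
    using stereo_chart_in_atlas[OF s(1)] assms unfolding nO2_atlas_def by blast
  moreover have "p \<in> fst ?e" using p s qL by simp
  ultimately show "p \<in> points (nO2_atlas t)" by (rule chart_points)
qed

text \<open>The criterion for maps to the total space lying over a base map \<open>\<pi>\<close>,
  with fibre part projected from a vector for each \<open>v\<close>. \<open>J\<pi>\<close> is
  holomorphy of the base map; \<open>Ja\<close> leaves the multiple of \<open>\<pi> p\<close> free,
  since the projection discards it.\<close>

lemma holomorphic_map_nO2_section:
  fixes C :: "('p, 'f::euclidean_space) chart set"
    and a :: "'p \<Rightarrow> ('t, real^'n) tangent \<Rightarrow> real^3 \<Rightarrow> real"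
    and b :: "'n \<Rightarrow> ('t, real^'n) tangent"
  assumes C: "smooth_atlas C"
    and b: "inj b" "independent (range b)" "span (range b) = t"
    and \<pi>: "smooth_map C sphere_atlas \<pi>"
    and lin: "\<And>p q. p \<in> points C \<Longrightarrow> linear_on t (\<lambda>v. a p v q)"
    and smooth: "\<And>v. v \<in> t \<Longrightarrow> smooth_function C (\<lambda>p. im_dual (a p v))"
    and J: "\<And>p \<xi>. p \<in> points C \<Longrightarrow> \<xi> \<in> tangent_space C p \<Longrightarrow> J p \<xi> \<in> tangent_space C p"
    and J\<pi>: "\<And>p \<xi>. p \<in> points C \<Longrightarrow> \<xi> \<in> tangent_space C p \<Longrightarrow>
      differential C sphere_atlas \<pi> p (J p \<xi>) = sphere_J (\<pi> p) (differential C sphere_atlas \<pi> p \<xi>)"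
    and Ja: "\<And>p \<xi> v. p \<in> points C \<Longrightarrow> \<xi> \<in> tangent_space C p \<Longrightarrow> v \<in> t \<Longrightarrow>
      \<exists>r. differential_fun C (\<lambda>p. im_dual (a p v)) p (J p \<xi>) =
        r *\<^sub>R \<pi> p + cross3 (\<pi> p) (differential_fun C (\<lambda>p. im_dual (a p v)) p \<xi>)"
  shows "holomorphic_map C J (nO2_atlas t) nO2_J (\<lambda>p. nO2_section t (a p) (\<pi> p))"
proof -
  let ?F = "\<lambda>p. nO2_section t (a p) (\<pi> p)"
  have sub: "subspace t" using b(3) subspace_span by blast
  have \<pi>S: "\<pi> p \<in> sphere 0 1" if "p \<in> points C" for p
    using smooth_map_points[OF \<pi> that] by (simp only: points_sphere_atlas)
  have FP: "?F p \<in> nO2_points t" if "p \<in> points C" for p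
    by (rule nO2_section_points[OF sub \<pi>S[OF that] lin[OF that]])
  \<comment> \<open>A bundle chart restricts only the base point, not the element of the
    fibre.\<close>
  have dom: "{p\<in>fst c. ?F p \<in> fst e} = {p\<in>fst c. \<pi> p \<in> fst (stereo_chart s)}"
    if "c \<in> C" "fst e = {(q, L) \<in> nO2_points t. q \<in> fst (stereo_chart s)}" for c e s
    using FP chart_points[OF that(1)] unfolding that(2) by (fastforce simp: nO2_section_def)
  \<comment> \<open>The basis belonging to an arbitrary bundle chart need not be the one fixed in
    the hypotheses, hence the newly bound \<open>b\<close>.\<close>
  have val: "snd e (?F p) = (stereo s (\<pi> p), \<chi> k. nO2_poly s (stereo s (\<pi> p)) (im_dual (a p (b k))))"
    if "s * s = 1" "\<pi> p \<in> fst (stereo_chart s)" "range b \<subseteq> t"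
      "snd e = (\<lambda>(q, L). (stereo s q, \<chi> k. L (b k) (stereo_chart s)))" for p s e and b :: "'n \<Rightarrow> _"
  proof -
    have "fst (?F p) = \<pi> p" by (simp add: nO2_section_def)
    moreover have "snd (?F p) (b k) (stereo_chart s) = nO2_poly s (stereo s (\<pi> p)) (im_dual (a p (b k)))" for k
      by (rule nO2_section_stereo[OF that(1,2)]) (use that(3) in auto)
    ultimately show ?thesis by (simp add: that(4) case_prod_beta)
  qed
  let ?Z = "\<lambda>s c. stereo s \<circ> \<pi> \<circ> chart_inv c"
  let ?A = "\<lambda>c v. (\<lambda>p. im_dual (a p v)) \<circ> chart_inv c"
  let ?G = "\<lambda>s b c y. (?Z s c y, \<chi> k :: 'n. nO2_poly s (?Z s c y) (?A c (b k) y))"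
  have G: "?G s b c y = (snd e \<circ> ?F \<circ> chart_inv c) y"
    if "c \<in> C" "y \<in> snd c ` {p\<in>fst c. \<pi> p \<in> fst (stereo_chart s)}" "s * s = 1" "range b \<subseteq> t"
      "snd e = (\<lambda>(q, L). (stereo s q, \<chi> k. L (b k) (stereo_chart s)))" for c s b y e
    using that(2) by (auto simp: chart_inv_atlas[OF C that(1)] val[OF that(3) _ that(4,5)])
  have "smooth_map C (nO2_atlas t) ?F"
    unfolding smooth_map_def
  proof (intro conjI ballI)
    show "?F ` points C \<subseteq> points (nO2_atlas t)"
      unfolding points_nO2_atlas[OF b] using FP by blast
  next
    fix c e assume c: "c \<in> C" and e: "e \<in> nO2_atlas t"
    obtain s b where s: "s * s = 1" "range b \<subseteq> t" and e': "e = ({(q, L) \<in> nO2_points t. q \<in> fst (stereo_chart s)},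
      \<lambda>(q, L). (stereo s q, \<chi> k. L (b k) (stereo_chart s)))"
      using e by (rule nO2_atlasE)
    let ?U = "snd c ` {p\<in>fst c. \<pi> p \<in> fst (stereo_chart s)}"
    have eq: "snd c ` {p\<in>fst c. ?F p \<in> fst e} = ?U"
      using dom[OF c, of e s] e' by simp
    have U: "open ?U" by (rule smooth_map_open[OF \<pi> c stereo_chart_in_atlas[OF s(1)]])
    then show "open (snd c ` {p\<in>fst c. ?F p \<in> fst e})" unfolding eq .
    have Z: "smooth_on ?U (?Z s c)"
      using smooth_map_smooth_on[OF \<pi> c stereo_chart_in_atlas[OF s(1)]] by simp
    have A: "smooth_on ?U (?A c (b k))" for k
      by (rule smooth_on_subset[of "snd c ` fst c"])
        (use smooth[of "b k"] s(2) c in \<open>auto simp: smooth_function_def\<close>)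
    have "smooth_on ?U (?G s b c)"
      by (rule smooth_on_Pair[OF U Z smooth_on_vec_lambda[OF U smooth_on_nO2_poly[OF U Z A]]])
    then have "smooth_on ?U (snd e \<circ> ?F \<circ> chart_inv c)"
      by (rule smooth_on_cong[OF U]) (rule G[OF c _ s], simp_all add: e')
    then show "smooth_on (snd c ` {p\<in>fst c. ?F p \<in> fst e}) (snd e \<circ> ?F \<circ> chart_inv c)"
      unfolding eq .
  qed
  moreover have "differential C (nO2_atlas t) ?F p (J p \<xi>) = nO2_J (?F p) (differential C (nO2_atlas t) ?F p \<xi>)"
    if p: "p \<in> points C" and \<xi>: "\<xi> \<in> tangent_space C p" for p \<xi>
  proof
    fix e
    show "differential C (nO2_atlas t) ?F p (J p \<xi>) e = nO2_J (?F p) (differential C (nO2_atlas t) ?F p \<xi>) e"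
    proof (cases "e \<in> nO2_atlas t \<and> ?F p \<in> fst e")
      \<comment> \<open>At charts that do not contain the image point both sides have the default
        value zero, which \<open>nO2_J\<close> preserves.\<close>
      case False
      then show ?thesis by (auto simp: differential_def nO2_J_def zero_prod_def vec_eq_iff)
    next
      case True
      then have e: "e \<in> nO2_atlas t" by blast
      obtain s b where s: "s * s = 1" "range b \<subseteq> t" and e': "e = ({(q, L) \<in> nO2_points t. q \<in> fst (stereo_chart s)},
        \<lambda>(q, L). (stereo s q, \<chi> k. L (b k) (stereo_chart s)))"
        using e by (rule nO2_atlasE)
      let ?d = "stereo_chart s"
      have d: "?d \<in> sphere_atlas" by (rule stereo_chart_in_atlas[OF s(1)])
      have bt: "b k \<in> t" for k using s(2) by auto
      have \<pi>p: "\<pi> p \<in> fst ?d" using True e' by (auto simp: nO2_section_def)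
      obtain c where c: "c \<in> C" "p \<in> fst c" using p by (auto simp: points_iff)
      let ?U = "snd c ` {p\<in>fst c. \<pi> p \<in> fst ?d}" and ?y = "snd c p"
      have U: "open ?U" by (rule smooth_map_open[OF \<pi> c(1) d])
      have y: "?y \<in> ?U" using c \<pi>p by blast
      define z' where "z' = frechet_derivative (?Z s c) (at ?y)"
      define A' where "A' = (\<lambda>k. frechet_derivative (?A c (b k)) (at ?y))"
      define z where "z = ?Z s c ?y"
      have z: "stereo_inv s z = \<pi> p"
        by (simp add: z_def chart_inv_atlas[OF C c] stereo_inv_stereo[OF s(1) \<pi>p])
      have Z: "(?Z s c has_derivative z') (at ?y)"
        using smooth_map_has_derivative[OF \<pi> c(1) d c(2) \<pi>p] by (simp add: z'_def)
      have A: "(?A c (b k) has_derivative A' k) (at ?y)" for k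
        unfolding A'_def by (rule smooth_function_differentiable[OF C smooth[OF bt] c])
      \<comment> \<open>\<open>P k\<close> does not depend on the direction of differentiation, so
        its term is complex linear once \<open>z'\<close> is.\<close>
      define P where "P = (\<lambda>k. nO2_poly_deriv s z (?A c (b k) ?y))"
      have "(?G s b c has_derivative (\<lambda>u. (z' u, \<chi> k. nO2_poly s z (A' k u) + P k * z' u))) (at ?y)"
        unfolding z_def P_def
        by (rule has_derivative_Pair[OF Z has_derivative_vec_lambda[OF has_derivative_nO2_poly[OF Z A]]])
      then have "((snd e \<circ> ?F \<circ> chart_inv c) has_derivative
          (\<lambda>u. (z' u, \<chi> k. nO2_poly s z (A' k u) + P k * z' u))) (at ?y)"
        by (rule has_derivative_transform_within_open[OF _ U y]) (rule G[OF c(1) _ s], simp_all add: e')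
      then have dF: "differential C (nO2_atlas t) ?F p \<zeta> e =
          (z' (\<zeta> c), \<chi> k. nO2_poly s z (A' k (\<zeta> c)) + P k * z' (\<zeta> c))"
        if "\<zeta> \<in> tangent_space C p" for \<zeta>
        using differential_fun_eq[OF C c that] True by (simp add: differential_def)
      have J\<xi>: "J p \<xi> \<in> tangent_space C p" by (rule J[OF p \<xi>])
      have dz: "differential C sphere_atlas \<pi> p \<zeta> ?d = z' (\<zeta> c)" if "\<zeta> \<in> tangent_space C p" for \<zeta>
        using differential_apply[OF C \<pi> c(1) d c(2) \<pi>p that] by (simp add: z'_def)
      have 1: "z' (J p \<xi> c) = \<i> * z' (\<xi> c)"
        using sphere_J_apply[OF differential_tangent[OF C smooth_atlas_sphere \<pi> p \<xi>] d \<pi>p]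
        by (simp add: dz[OF \<xi>] dz[OF J\<xi>, symmetric] J\<pi>[OF p \<xi>])
      have 2: "nO2_poly s z (A' k (J p \<xi> c)) = \<i> * nO2_poly s z (A' k (\<xi> c))" for k
      proof -
        have dA: "differential_fun C (\<lambda>p. im_dual (a p (b k))) p \<zeta> = A' k (\<zeta> c)"
          if "\<zeta> \<in> tangent_space C p" for \<zeta>
          by (rule differential_fun_eq[OF C c that A])
        obtain r where "A' k (J p \<xi> c) = r *\<^sub>R \<pi> p + cross3 (\<pi> p) (A' k (\<xi> c))"
          using Ja[OF p \<xi> bt[of k]] unfolding dA[OF \<xi>] dA[OF J\<xi>] by blast
        then show ?thesis using nO2_poly_J[OF s(1), of z] by (simp add: z)
      qed
      show ?thesis
        unfolding dF[OF J\<xi>] nO2_J_def dF[OF \<xi>] 1 2 by (simp add: vec_eq_iff algebra_simps)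
    qed
  qed
  ultimately show ?thesis by (simp add: holomorphic_map_def)
qed

section \<open>Quaternionic linear algebra of a hyper-Kaehler metric\<close>

context
  fixes A :: "('m, 'e::euclidean_space) chart set"
    and g :: "'m \<Rightarrow> ('m, 'e) tangent \<Rightarrow> ('m, 'e) tangent \<Rightarrow> real"
    and J :: "3 \<Rightarrow> 'm \<Rightarrow> ('m, 'e) tangent \<Rightarrow> ('m, 'e) tangent"
    and x :: 'm
  assumes hk: "hyperkaehler A g J" and x: "x \<in> points A"
begin

lemma hyperkaehler_smooth_atlas: "smooth_atlas A"
  using hk by (simp add: hyperkaehler_def smooth_manifold_def)

lemma hyperkaehler_subspace: "subspace (tangent_space A x)"
  by (rule subspace_tangent_space[OF hyperkaehler_smooth_atlas])

lemma hyperkaehler_J_tangent: "\<xi> \<in> tangent_space A x \<Longrightarrow> J j x \<xi> \<in> tangent_space A x"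
  using hk x by (simp add: hyperkaehler_def kaehler_def almost_complex_def)

lemma hyperkaehler_J_J: "\<xi> \<in> tangent_space A x \<Longrightarrow> J j x (J j x \<xi>) = - \<xi>"
  using hk x by (simp add: hyperkaehler_def kaehler_def almost_complex_def)

lemma hyperkaehler_J_minus: "\<xi> \<in> tangent_space A x \<Longrightarrow> J j x (- \<xi>) = - J j x \<xi>"
proof -
  assume "\<xi> \<in> tangent_space A x"
  moreover have "linear_on (tangent_space A x) (J j x)"
    using hk x by (simp add: hyperkaehler_def kaehler_def almost_complex_def)
  ultimately have "J j x ((- 1) *\<^sub>R \<xi>) = (- 1) *\<^sub>R J j x \<xi>"
    unfolding linear_on_def by blast
  then show ?thesis by simp
qed

lemma hyperkaehler_metric_linear: "\<xi> \<in> tangent_space A x \<Longrightarrow> linear_on (tangent_space A x) (g x \<xi>)"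
  using hk x by (simp add: hyperkaehler_def kaehler_def riemannian_metric_def)

lemma hyperkaehler_metric_sym:
  "\<xi> \<in> tangent_space A x \<Longrightarrow> \<eta> \<in> tangent_space A x \<Longrightarrow> g x \<xi> \<eta> = g x \<eta> \<xi>"
  using hk x by (simp add: hyperkaehler_def kaehler_def riemannian_metric_def)

lemma hyperkaehler_metric_J:
  "\<xi> \<in> tangent_space A x \<Longrightarrow> \<eta> \<in> tangent_space A x \<Longrightarrow> g x (J j x \<xi>) (J j x \<eta>) = g x \<xi> \<eta>"
  using hk x by (simp add: hyperkaehler_def kaehler_def)

lemma hyperkaehler_metric_minus:
  assumes "\<xi> \<in> tangent_space A x" "\<eta> \<in> tangent_space A x"
  shows "g x \<xi> (- \<eta>) = - g x \<xi> \<eta>" "g x (- \<xi>) \<eta> = - g x \<xi> \<eta>"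
proof -
  have *: "g x \<xi> (- \<eta>) = - g x \<xi> \<eta>" if "\<xi> \<in> tangent_space A x" "\<eta> \<in> tangent_space A x" for \<xi> \<eta>
  proof -
    have "g x \<xi> ((- 1) *\<^sub>R \<eta>) = (- 1) *\<^sub>R g x \<xi> \<eta>"
      using hyperkaehler_metric_linear[OF that(1)] that(2) unfolding linear_on_def by blast
    then show ?thesis by simp
  qed
  show "g x \<xi> (- \<eta>) = - g x \<xi> \<eta>" by (rule *[OF assms])
  have "- \<xi> \<in> tangent_space A x" by (rule subspace_neg[OF hyperkaehler_subspace assms(1)])
  then show "g x (- \<xi>) \<eta> = - g x \<xi> \<eta>"
    using *[OF assms(2,1)] hyperkaehler_metric_sym assms by metis
qed

text \<open>Apply the isometry \<open>J j\<close> to both arguments; its square is minus the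
  identity.\<close>

lemma hyperkaehler_skew:
  assumes "\<xi> \<in> tangent_space A x" "\<eta> \<in> tangent_space A x"
  shows "g x \<xi> (J j x \<eta>) = - g x (J j x \<xi>) \<eta>"
proof -
  have "g x \<xi> (J j x \<eta>) = g x (J j x \<xi>) (J j x (J j x \<eta>))"
    using hyperkaehler_metric_J hyperkaehler_J_tangent assms by metis
  then show ?thesis
    using hyperkaehler_J_J[OF assms(2)] hyperkaehler_metric_minus(1)[OF hyperkaehler_J_tangent[OF assms(1)] assms(2)]
    by metis
qed

text \<open>The remaining products follow from J_1 J_2 = J_3 = - J_2 J_1 and the squares, for
  instance J_3 J_2 = J_1 J_2 J_2 = - J_1 and J_2 J_3 = J_2 J_1 J_2 = - J_3 J_2 = J_1.\<close>

lemma hyperkaehler_products: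
  assumes "\<xi> \<in> tangent_space A x"
  shows "J 1 x (J 2 x \<xi>) = J 3 x \<xi>" "J 2 x (J 1 x \<xi>) = - J 3 x \<xi>"
    and "J 2 x (J 3 x \<xi>) = J 1 x \<xi>" "J 3 x (J 2 x \<xi>) = - J 1 x \<xi>"
    and "J 3 x (J 1 x \<xi>) = J 2 x \<xi>" "J 1 x (J 3 x \<xi>) = - J 2 x \<xi>"
proof -
  have T: "J i x \<xi> \<in> tangent_space A x" for i by (rule hyperkaehler_J_tangent[OF assms])
  have 12: "J 1 x (J 2 x \<eta>) = J 3 x \<eta>" "J 2 x (J 1 x \<eta>) = - J 3 x \<eta>" if "\<eta> \<in> tangent_space A x" for \<eta>
    using hk x that by (simp_all add: hyperkaehler_def)
  show "J 1 x (J 2 x \<xi>) = J 3 x \<xi>" "J 2 x (J 1 x \<xi>) = - J 3 x \<xi>" using 12[OF assms] .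
  show 32: "J 3 x (J 2 x \<xi>) = - J 1 x \<xi>"
    using 12(1)[OF T[of 2]] hyperkaehler_J_J[OF assms, of 2] hyperkaehler_J_minus[OF assms, of 1] by metis
  show 13: "J 1 x (J 3 x \<xi>) = - J 2 x \<xi>"
    using 12(1)[OF assms] hyperkaehler_J_J[OF T[of 2], of 1] by metis
  show "J 2 x (J 3 x \<xi>) = J 1 x \<xi>"
    using 12(2)[OF T[of 2]] 12(1)[OF assms] 32 by (metis minus_minus)
  show "J 3 x (J 1 x \<xi>) = J 2 x \<xi>"
    using 12(1)[OF T[of 1]] 12(2)[OF assms] hyperkaehler_J_minus[OF T[of 3], of 1] 13 by (metis minus_minus)
qed

lemma admissible_tangent:
  assumes "\<xi> \<in> tangent_space A x"
  shows "admissible J q x \<xi> \<in> tangent_space A x"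
  unfolding admissible_def
  by (intro subspace_sum subspace_scale hyperkaehler_subspace hyperkaehler_J_tangent assms)

text \<open>By skewness the j-th entry is minus the sum over i of q_i g(J_i J_j \<xi>, \<eta>). The
  term with i = j contributes q_j g(\<xi>, \<eta>); in the others J_i and J_j multiply like
  imaginary units, which produces the cross product.\<close>

lemma metric_admissible:
  assumes "\<xi> \<in> tangent_space A x" "\<eta> \<in> tangent_space A x"
  shows "(\<chi> j. g x (J j x \<xi>) (admissible J q x \<eta>)) =
    g x \<xi> \<eta> *\<^sub>R q + cross3 q (\<chi> j. g x (J j x \<xi>) \<eta>)"
proof -
  have T: "J i x \<zeta> \<in> tangent_space A x" if "\<zeta> \<in> tangent_space A x" for i \<zeta>
    by (rule hyperkaehler_J_tangent[OF that])
  have sum: "g x (J j x \<xi>) (admissible J q x \<eta>) = (\<Sum>i\<in>UNIV. q $ i * - g x (J i x (J j x \<xi>)) \<eta>)" for j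
  proof -
    note lin = hyperkaehler_metric_linear[OF T[OF assms(1)], unfolded linear_on_def]
    have S: "q $ i *\<^sub>R J i x \<eta> \<in> tangent_space A x" for i
      by (intro subspace_scale hyperkaehler_subspace T assms)
    have "g x (J j x \<xi>) (admissible J q x \<eta>) = (\<Sum>i\<in>UNIV. q $ i * g x (J j x \<xi>) (J i x \<eta>))"
      unfolding admissible_def sum_3
      using lin S T[OF assms(2)] subspace_add[OF hyperkaehler_subspace S S] by simp
    then show ?thesis
      by (simp add: hyperkaehler_skew[OF T[OF assms(1)] assms(2)])
  qed
  show ?thesis
    unfolding sum sum_3 vec_eq_iff forall_3
    using hyperkaehler_products[OF assms(1)] hyperkaehler_J_J[OF assms(1)]
      hyperkaehler_metric_minus(2) T assms
    by (simp add: cross3_def algebra_simps)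
qed

end

section \<open>The twistor space\<close>

context
  fixes A :: "('m, 'e::euclidean_space) chart set"
    and g :: "'m \<Rightarrow> ('m, 'e) tangent \<Rightarrow> ('m, 'e) tangent \<Rightarrow> real"
    and J :: "3 \<Rightarrow> 'm \<Rightarrow> ('m, 'e) tangent \<Rightarrow> ('m, 'e) tangent"
    and z :: "'m \<times> (real^3)" and \<zeta> :: "('m \<times> (real^3), 'e \<times> complex) tangent"
  assumes hk: "hyperkaehler A g J" and z: "z \<in> points (twistor_atlas A)"
    and \<zeta>: "\<zeta> \<in> tangent_space (twistor_atlas A) z"
begin

text \<open>A projection composed with a slice inclusion is either the identity or constant. Hence,
  by the chain rule, the differential of each projection keeps one of the two summands of
  \<open>twistor_J\<close> and kills the other.\<close>

lemma
  shows twistor_J_tangent: "twistor_J A J z \<zeta> \<in> tangent_space (twistor_atlas A) z"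
    and differential_fst_twistor_J: "differential (twistor_atlas A) A fst z (twistor_J A J z \<zeta>) =
      admissible J (snd z) (fst z) (differential (twistor_atlas A) A fst z \<zeta>)"
    and differential_snd_twistor_J: "differential (twistor_atlas A) sphere_atlas snd z (twistor_J A J z \<zeta>) =
      sphere_J (snd z) (differential (twistor_atlas A) sphere_atlas snd z \<zeta>)"
proof -
  let ?Z = "twistor_atlas A"
  obtain x q where xq: "z = (x, q)" by (cases z)
  have x: "x \<in> points A" and q: "q \<in> points sphere_atlas"
    using z by (auto simp: xq twistor_atlas_def points_prod_atlas)
  have qS: "q \<in> sphere 0 1" using q by (simp only: points_sphere_atlas)
  note A = hyperkaehler_smooth_atlas[OF hk x] and S = smooth_atlas_sphere
  have Z: "smooth_atlas ?Z" unfolding twistor_atlas_def by (rule smooth_atlas_prod[OF A S])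
  have sm: "smooth_map ?Z A fst" "smooth_map ?Z sphere_atlas snd"
    "smooth_map A ?Z (\<lambda>y. (y, q))" "smooth_map sphere_atlas ?Z (\<lambda>p. (x, p))"
    unfolding twistor_atlas_def
    using smooth_map_fst[OF A S] smooth_map_snd[OF A S] smooth_map_slice_left[OF A q]
      smooth_map_slice_right[OF S x] by auto
  define \<eta> where "\<eta> = admissible J q x (differential ?Z A fst z \<zeta>)"
  define \<theta> where "\<theta> = sphere_J q (differential ?Z sphere_atlas snd z \<zeta>)"
  have \<eta>: "\<eta> \<in> tangent_space A x"
    unfolding \<eta>_def using differential_tangent[OF Z A sm(1) z \<zeta>]
    by (intro admissible_tangent[OF hk x]) (simp add: xq)
  have \<theta>: "\<theta> \<in> tangent_space sphere_atlas q"
    unfolding \<theta>_def by (rule sphere_J_tangent[OF qS])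
  let ?\<eta> = "differential A ?Z (\<lambda>y. (y, q)) x \<eta>" and ?\<theta> = "differential sphere_atlas ?Z (\<lambda>p. (x, p)) q \<theta>"
  have tJ: "twistor_J A J z \<zeta> = ?\<eta> + ?\<theta>"
    by (simp add: twistor_J_def xq \<eta>_def \<theta>_def)
  have T: "?\<eta> \<in> tangent_space ?Z z" "?\<theta> \<in> tangent_space ?Z z"
    using differential_tangent[OF A Z sm(3) x \<eta>] differential_tangent[OF S Z sm(4) q \<theta>] by (simp_all add: xq)
  then show "twistor_J A J z \<zeta> \<in> tangent_space ?Z z"
    unfolding tJ by (rule subspace_add[OF subspace_tangent_space[OF Z]])
  have "differential ?Z A fst z ?\<eta> = \<eta>" "differential ?Z sphere_atlas snd z ?\<eta> = 0"
    using differential_chain[OF A Z sm(3) sm(1) x \<eta>] differential_chain[OF A Z sm(3) sm(2) x \<eta>]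
    by (simp_all add: xq differential_ident[OF A \<eta>] differential_const)
  moreover have "differential ?Z A fst z ?\<theta> = 0" "differential ?Z sphere_atlas snd z ?\<theta> = \<theta>"
    using differential_chain[OF S Z sm(4) sm(1) q \<theta>] differential_chain[OF S Z sm(4) sm(2) q \<theta>]
    by (simp_all add: xq differential_ident[OF S \<theta>] differential_const)
  ultimately show
    "differential ?Z A fst z (twistor_J A J z \<zeta>) = admissible J (snd z) (fst z) (differential ?Z A fst z \<zeta>)"
    "differential ?Z sphere_atlas snd z (twistor_J A J z \<zeta>) =
      sphere_J (snd z) (differential ?Z sphere_atlas snd z \<zeta>)"
    unfolding tJ differential_add[OF Z sm(1) z T] differential_add[OF Z sm(2) z T]
    by (simp_all add: \<eta>_def \<theta>_def xq)
qed

end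

section \<open>The differential of the hyper-Kaehler moment map\<close>

lemma fundamental_field_tangent:
  assumes "lie_group_action T AT A \<rho>" "smooth_atlas A" "x \<in> points A" "v \<in> lie_algebra T AT"
  shows "fundamental_field T AT A \<rho> v x \<in> tangent_space A x"
proof -
  have G: "group T" and AT: "smooth_atlas AT" "points AT = carrier T" and act: "group_action T (points A) \<rho>"
    and sm: "smooth_map (prod_atlas AT A) A (\<lambda>(t, x). \<rho> t x)"
    using assms(1) by (auto simp: lie_group_action_def lie_group_def smooth_manifold_def)
  have one: "\<one>\<^bsub>T\<^esub> \<in> points AT"
    using G AT(2) group.is_monoid monoid.one_closed by metis
  have "smooth_map AT A (\<lambda>t. \<rho> t x)"
    using smooth_map_compose[OF AT(1) smooth_atlas_prod[OF AT(1) assms(2)]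
      smooth_map_slice_left[OF AT(1) assms(3)] sm] by simp
  from differential_tangent[OF AT(1) assms(2) this one]
  have "fundamental_field T AT A \<rho> v x \<in> tangent_space A (\<rho> \<one>\<^bsub>T\<^esub> x)"
    using assms(4) by (simp add: fundamental_field_def lie_algebra_def)
  \<comment> \<open>The differential of the orbit map takes values at the image of the unit, which
    has to be identified with \<open>x\<close>.\<close>
  moreover have "\<rho> \<one>\<^bsub>T\<^esub> x = x"
    using group_action.id_eq_one[OF act] assms(3) by (metis restrict_apply')
  ultimately show ?thesis by simp
qed

text \<open>Up to the sign \<open>\<sigma>\<close>, the components of the differential are the
  values of g(J_j V, .) for the fundamental field V, so \<open>metric_admissible\<close> applies
  with V as its first vector.\<close>

lemma differential_moment_map_admissible:
  assumes "hyperkaehler A g J" "lie_group_action T AT A \<rho>" "hyperkaehler_moment_map T AT A g J \<rho> \<phi>"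
    and "v \<in> lie_algebra T AT"
  shows "smooth_function A (\<lambda>y. im_dual (\<phi> y v))"
    and "x \<in> points A \<Longrightarrow> \<xi> \<in> tangent_space A x \<Longrightarrow>
      \<exists>r. differential_fun A (\<lambda>y. im_dual (\<phi> y v)) x (admissible J q x \<xi>) =
        r *\<^sub>R q + cross3 q (differential_fun A (\<lambda>y. im_dual (\<phi> y v)) x \<xi>)"
proof -
  obtain \<sigma> :: real where \<sigma>: "\<And>q. q \<in> sphere 0 1 \<Longrightarrow> smooth_function A (\<lambda>x. \<phi> x v q)"
    "\<And>q x \<xi>. q \<in> sphere 0 1 \<Longrightarrow> x \<in> points A \<Longrightarrow> \<xi> \<in> tangent_space A x \<Longrightarrow>
      differential_fun A (\<lambda>y. \<phi> y v q) x \<xi> = \<sigma> * kaehler_form g J q x (fundamental_field T AT A \<rho> v x) \<xi>"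
    using assms(3,4) unfolding hyperkaehler_moment_map_def by blast
  have A: "smooth_atlas A" using assms(1) by (simp add: hyperkaehler_def smooth_manifold_def)
  \<comment> \<open>The moment map equation concerns unit vectors; the three coordinate units are
    those from which \<open>im_dual\<close> is assembled.\<close>
  have ax: "(axis j 1 :: real^3) \<in> sphere 0 1" for j
    by simp
  show "smooth_function A (\<lambda>y. im_dual (\<phi> y v))"
    unfolding im_dual_def by (rule smooth_function_vec_lambda[OF A \<sigma>(1)[OF ax]])
  assume x: "x \<in> points A" and \<xi>: "\<xi> \<in> tangent_space A x"
  define V where "V = fundamental_field T AT A \<rho> v x"
  have V: "V \<in> tangent_space A x"
    unfolding V_def by (rule fundamental_field_tangent[OF assms(2) A x assms(4)])
  have "admissible J (axis j 1) x V = J j x V" for j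
  proof -
    have "axis j 1 $ i *\<^sub>R J i x V = (if i = j then J i x V else 0)" for i
      by (simp add: axis_def)
    then show ?thesis by (simp add: admissible_def)
  qed
  then have D: "differential_fun A (\<lambda>y. im_dual (\<phi> y v)) x \<eta> = \<sigma> *\<^sub>R (\<chi> j. g x (J j x V) \<eta>)"
    if "\<eta> \<in> tangent_space A x" for \<eta>
    unfolding im_dual_def differential_fun_vec_lambda[OF A \<sigma>(1)[OF ax] x that]
    by (simp add: \<sigma>(2)[OF ax x that] kaehler_form_def vec_eq_iff flip: V_def)
  show "\<exists>r. differential_fun A (\<lambda>y. im_dual (\<phi> y v)) x (admissible J q x \<xi>) =
      r *\<^sub>R q + cross3 q (differential_fun A (\<lambda>y. im_dual (\<phi> y v)) x \<xi>)"
    \<comment> \<open>The witness is the coefficient of \<open>q\<close> in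
      \<open>metric_admissible\<close>, multiplied by the sign convention.\<close>
    by (rule exI[of _ "\<sigma> * g x V \<xi>"])
      (simp add: D[OF \<xi>] D[OF admissible_tangent[OF assms(1) x \<xi>]] metric_admissible[OF assms(1) x V \<xi>]
        scaleR_add_right cross_mult_right)
qed

text \<open>The criterion with the identity as base map and a constant vector for each
  \<open>v\<close>: the derivative of the vector vanishes, and only the polynomial dependence on the
  coordinate of the sphere remains.\<close>

lemma holomorphic_section_nO2_section:
  fixes b :: "'n \<Rightarrow> ('t, real^'n) tangent"
  assumes "inj b" "independent (range b)" "span (range b) = t"
    and "\<And>q. linear_on t (\<lambda>v. f v q)"
  shows "holomorphic_section t (nO2_section t f)"
proof -
  have "holomorphic_map sphere_atlas sphere_J (nO2_atlas t) nO2_J (\<lambda>q. nO2_section t f q)"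
  proof (rule holomorphic_map_nO2_section[OF smooth_atlas_sphere assms(1-3)
        smooth_map_ident[OF smooth_atlas_sphere] assms(4)])
    fix v
    show "smooth_function sphere_atlas (\<lambda>p. im_dual (f v))"
      by (simp add: smooth_function_def o_def smooth_on_const)
  next
    fix p \<xi> assume *: "p \<in> points sphere_atlas" "\<xi> \<in> tangent_space sphere_atlas p"
    then have "p \<in> sphere 0 1" by (simp only: points_sphere_atlas)
    then show J: "sphere_J p \<xi> \<in> tangent_space sphere_atlas p" by (rule sphere_J_tangent)
    show "differential sphere_atlas sphere_atlas (\<lambda>q. q) p (sphere_J p \<xi>) =
        sphere_J p (differential sphere_atlas sphere_atlas (\<lambda>q. q) p \<xi>)"
      by (simp add: differential_ident[OF smooth_atlas_sphere J] differential_ident[OF smooth_atlas_sphere *(2)])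
  next
    fix p \<xi> v
    show "\<exists>r. differential_fun sphere_atlas (\<lambda>p. im_dual (f v)) p (sphere_J p \<xi>) =
        r *\<^sub>R p + cross3 p (differential_fun sphere_atlas (\<lambda>p. im_dual (f v)) p \<xi>)"
      by (rule exI[of _ 0]) (simp add: differential_fun_const)
  qed
  then show ?thesis
    by (simp add: holomorphic_section_def) (simp add: nO2_section_def)
qed

theorem proposition3p5:
  fixes T :: "('t, 'z) monoid_scheme"
    and AT :: "('t, real^'n) chart set"
    and A :: "('m, 'e::euclidean_space) chart set"
    and g :: "'m \<Rightarrow> ('m, 'e) tangent \<Rightarrow> ('m, 'e) tangent \<Rightarrow> real"
    and J :: "3 \<Rightarrow> 'm \<Rightarrow> ('m, 'e) tangent \<Rightarrow> ('m, 'e) tangent"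
    and \<rho> :: "'t \<Rightarrow> 'm \<Rightarrow> 'm"
    and \<phi> :: "'m \<Rightarrow> ('t, real^'n) tangent \<Rightarrow> real^3 \<Rightarrow> real"
  assumes "lie_group T AT"
    and "comm_group T"
    and "connected_space (manifold_topology AT)"
    and "hyperkaehler A g J"
    and "connected_space (manifold_topology A)"
    and "betti_number 1 (manifold_topology A) = 0"
    and "lie_group_action T AT A \<rho>"
    and "triholomorphic_isometries T A g J \<rho>"
    and "nontrivial_action T A \<rho>"
    and "hyperkaehler_moment_map T AT A g J \<rho> \<phi>"
  shows "twistorial A J (lie_algebra T AT) \<phi> \<and>
    (\<forall>x\<in>points A.
       holomorphic_section (lie_algebra T AT) (nO2_section (lie_algebra T AT) (\<phi> x)) \<and>
       twistor_map (lie_algebra T AT) \<phi> ` ({x} \<times> sphere 0 1) =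
         nO2_section (lie_algebra T AT) (\<phi> x) ` sphere 0 1)"
proof -
  let ?t = "lie_algebra T AT" and ?Z = "twistor_atlas A"
  have AT: "smooth_atlas AT" "\<one>\<^bsub>T\<^esub> \<in> points AT"
    using assms(1) by (auto simp: lie_group_def smooth_manifold_def group.is_monoid monoid.one_closed)
  obtain b :: "'n \<Rightarrow> ('t, real^'n) tangent"
    where b: "inj b" "independent (range b)" "span (range b) = ?t"
    unfolding lie_algebra_def by (rule tangent_space_basis[OF AT])
  have lin: "linear_on ?t (\<lambda>v. \<phi> x v q)" if "x \<in> points A" for x q
    using assms(10) that by (simp add: hyperkaehler_moment_map_def)
  have A: "smooth_atlas A" using assms(4) by (simp add: hyperkaehler_def smooth_manifold_def)
  note S = smooth_atlas_sphere
  have Z: "smooth_atlas ?Z" and points_Z: "points ?Z = points A \<times> sphere 0 1"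
    and fst: "smooth_map ?Z A fst" and snd: "smooth_map ?Z sphere_atlas snd"
    unfolding twistor_atlas_def points_prod_atlas points_sphere_atlas
    by (auto intro: smooth_atlas_prod A S smooth_map_fst smooth_map_snd)
  note moment = differential_moment_map_admissible[OF assms(4,7,10)]
  have "holomorphic_map ?Z (twistor_J A J) (nO2_atlas ?t) nO2_J (\<lambda>z. nO2_section ?t (\<phi> (fst z)) (snd z))"
  proof (rule holomorphic_map_nO2_section[OF Z b snd])
    show "linear_on ?t (\<lambda>v. \<phi> (fst z) v q)" if "z \<in> points ?Z" for z q
      using lin that by (auto simp: points_Z)
    show "smooth_function ?Z (\<lambda>z. im_dual (\<phi> (fst z) v))" if "v \<in> ?t" for v
      by (rule smooth_function_compose[OF Z A fst moment(1)[OF that]])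
    fix z \<zeta> assume z: "z \<in> points ?Z" and \<zeta>: "\<zeta> \<in> tangent_space ?Z z"
    show J\<zeta>: "twistor_J A J z \<zeta> \<in> tangent_space ?Z z"
      by (rule twistor_J_tangent[OF assms(4) z \<zeta>])
    show "differential ?Z sphere_atlas snd z (twistor_J A J z \<zeta>) =
        sphere_J (snd z) (differential ?Z sphere_atlas snd z \<zeta>)"
      by (rule differential_snd_twistor_J[OF assms(4) z \<zeta>])
    fix v assume v: "v \<in> ?t"
    let ?f = "\<lambda>x. im_dual (\<phi> x v)"
    have x: "fst z \<in> points A" using z by (auto simp: points_Z)
    then obtain c where c: "c \<in> A" "fst z \<in> fst c" by (auto simp: points_iff)
    \<comment> \<open>As the vectors factor through \<open>fst\<close>, their derivative sees only
      the horizontal part of a tangent vector, on which \<open>twistor_J\<close> acts as the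
      admissible structure of the point \<open>snd z\<close>.\<close>
    have chain: "differential_fun ?Z (\<lambda>z. ?f (fst z)) z \<eta> = differential_fun A ?f (fst z) (differential ?Z A fst z \<eta>)"
      if "\<eta> \<in> tangent_space ?Z z" for \<eta>
      using differential_fun_chain[OF Z A fst z that c smooth_function_differentiable[OF A moment(1)[OF v] c]]
      by (simp add: o_def)
    show "\<exists>r. differential_fun ?Z (\<lambda>z. ?f (fst z)) z (twistor_J A J z \<zeta>) =
        r *\<^sub>R snd z + cross3 (snd z) (differential_fun ?Z (\<lambda>z. ?f (fst z)) z \<zeta>)"
      unfolding chain[OF \<zeta>] chain[OF J\<zeta>] differential_fst_twistor_J[OF assms(4) z \<zeta>]
      by (rule moment(2)[OF v x differential_tangent[OF Z A fst z \<zeta>]])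
  qed
  then have "twistorial A J ?t \<phi>"
    by (simp add: twistorial_def twistor_map_def case_prod_beta')
  moreover have "holomorphic_section ?t (nO2_section ?t (\<phi> x))" if "x \<in> points A" for x
    by (rule holomorphic_section_nO2_section[OF b lin[OF that]])
  moreover have "twistor_map ?t \<phi> ` ({x} \<times> sphere 0 1) = nO2_section ?t (\<phi> x) ` sphere 0 1" for x
  proof -
    have "{x} \<times> sphere 0 1 = Pair x ` (sphere 0 1 :: (real^3) set)" by auto
    then show ?thesis by (simp add: twistor_map_def image_image)
  qed
  ultimately show ?thesis by blast
qed

end
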